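(* Let $q$ be any odd prime power greater than $3$. Then $d^\natural_{(q+1)/2}\le \frac 2q$ and $d^\natural_{(q-1)/2}\le\frac 2q$.
   Context: For a finite group $G$ and complex representations $\rho,\rho'$ of $G$ with characters $\chi,\chi'$, put $\delta(\rho,\rho') = \frac{|\{g\in G : \chi(g)\neq\chi'(g)\}|}{|G|}$. An irreducible representation on $V$ is imprimitive if there is a nontrivial decomposition $V=W_1\oplus\cdots\oplus W_k$ ($k\ge2$) such that $G$ permutes the $W_j$ transitively (equivalently, it is induced from a representation of a proper subgroup); otherwise it is primitive. $\delta_n^\natural(G)$ is the infimum of $\delta(\rho,\rho')$ over pairs of inequivalent irreducible primitive $n$-dimensional complex representations of $G$ (and equals $1$ if there are no such pairs). $d_n^\natural=\inf_G\delta_n^\natural(G)$, where $G$ ranges over all finite groups. *)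

theory Defs
  imports "Jordan_Normal_Form.VS_Connect" "HOL-Algebra.Algebra" "HOL-Number_Theory.Prime_Powers"
begin

text \<open>
  An \<open>n\<close>-dimensional complex representation is a homomorphism into \<open>GL\<^sub>n(\<complex>)\<close>, i.e. the space
  is always \<open>\<complex>\<^sup>n\<close>, rendered as \<^term>\<open>carrier_vec n :: complex vec set\<close>.
\<close>

definition GL :: "nat \<Rightarrow> complex mat monoid" where
  "GL n = units_of (ring_mat TYPE(complex) n ())"

definition representation :: "nat \<Rightarrow> ('a, 'b) monoid_scheme \<Rightarrow> ('a \<Rightarrow> complex mat) \<Rightarrow> bool" where
  "representation n G \<rho> \<longleftrightarrow> \<rho> \<in> hom G (GL n)"

definition character :: "('a \<Rightarrow> complex mat) \<Rightarrow> 'a \<Rightarrow> complex" where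
  "character \<rho> g = (\<Sum>i<dim_row (\<rho> g). \<rho> g $$ (i, i))"

definition equivalent_reps ::
  "nat \<Rightarrow> ('a, 'b) monoid_scheme \<Rightarrow> ('a \<Rightarrow> complex mat) \<Rightarrow> ('a \<Rightarrow> complex mat) \<Rightarrow> bool" where
  "equivalent_reps n G \<rho> \<rho>' \<longleftrightarrow>
     (\<exists>T\<in>carrier (GL n). \<forall>g\<in>carrier G. T * \<rho> g = \<rho>' g * T)"

abbreviation is_subspace :: "nat \<Rightarrow> complex vec set \<Rightarrow> bool" where
  "is_subspace n W \<equiv> VectorSpace.subspace class_ring W (module_vec TYPE(complex) n)"

definition irreducible_rep ::
  "nat \<Rightarrow> ('a, 'b) monoid_scheme \<Rightarrow> ('a \<Rightarrow> complex mat) \<Rightarrow> bool" where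
  "irreducible_rep n G \<rho> \<longleftrightarrow> representation n G \<rho> \<and> n > 0 \<and>
     (\<forall>W. is_subspace n W \<and> (\<forall>g\<in>carrier G. \<forall>w\<in>W. \<rho> g *\<^sub>v w \<in> W)
        \<longrightarrow> W = {0\<^sub>v n} \<or> W = carrier_vec n)"

text \<open>
  Nonzero summands of a direct sum are pairwise distinct, so a decomposition can be given by the
  set of its summands.
\<close>

definition direct_sum_decomposition :: "nat \<Rightarrow> complex vec set set \<Rightarrow> bool" where
  "direct_sum_decomposition n \<W> \<longleftrightarrow> finite \<W> \<and>
     (\<forall>W\<in>\<W>. is_subspace n W \<and> W \<noteq> {0\<^sub>v n}) \<and>
     (\<forall>v\<in>carrier_vec n. \<exists>!w. w \<in> (\<Pi>\<^sub>E W\<in>\<W>. W) \<and> v = finsum_vec TYPE(complex) n w \<W>)"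

definition imprimitive_rep ::
  "nat \<Rightarrow> ('a, 'b) monoid_scheme \<Rightarrow> ('a \<Rightarrow> complex mat) \<Rightarrow> bool" where
  "imprimitive_rep n G \<rho> \<longleftrightarrow> irreducible_rep n G \<rho> \<and>
     (\<exists>\<W>. direct_sum_decomposition n \<W> \<and> card \<W> \<ge> 2 \<and>
        (\<forall>g\<in>carrier G. \<forall>W\<in>\<W>. (\<lambda>v. \<rho> g *\<^sub>v v) ` W \<in> \<W>) \<and>
        (\<forall>W\<in>\<W>. \<forall>W'\<in>\<W>. \<exists>g\<in>carrier G. (\<lambda>v. \<rho> g *\<^sub>v v) ` W = W'))"

definition primitive_rep ::
  "nat \<Rightarrow> ('a, 'b) monoid_scheme \<Rightarrow> ('a \<Rightarrow> complex mat) \<Rightarrow> bool" where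
  "primitive_rep n G \<rho> \<longleftrightarrow> irreducible_rep n G \<rho> \<and> \<not> imprimitive_rep n G \<rho>"

definition char_dist ::
  "('a, 'b) monoid_scheme \<Rightarrow> ('a \<Rightarrow> complex mat) \<Rightarrow> ('a \<Rightarrow> complex mat) \<Rightarrow> real" where
  "char_dist G \<rho> \<rho>' =
     real (card {g \<in> carrier G. character \<rho> g \<noteq> character \<rho>' g}) / real (Coset.order G)"

definition primitive_dists :: "nat \<Rightarrow> ('a, 'b) monoid_scheme \<Rightarrow> real set" where
  "primitive_dists n G = {char_dist G \<rho> \<rho>' | \<rho> \<rho>'.
     primitive_rep n G \<rho> \<and> primitive_rep n G \<rho>' \<and> \<not> equivalent_reps n G \<rho> \<rho>'}"

definition delta_natural :: "nat \<Rightarrow> ('a, 'b) monoid_scheme \<Rightarrow> real" where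
  "delta_natural n G = (if primitive_dists n G = {} then 1 else Inf (primitive_dists n G))"

text \<open>
  HOL cannot quantify over all groups of all types at once, but every finite group is isomorphic
  to one whose elements are natural numbers; \<open>d_natural_le\<close> below confirms that this
  loses nothing.
\<close>

definition d_natural :: "nat \<Rightarrow> real" where
  "d_natural n = (INF G \<in> {G :: nat monoid. group G \<and> finite (carrier G)}. delta_natural n G)"

lemma delta_natural_nonneg: "0 \<le> delta_natural n G"
proof -
  have "0 \<le> x" if "x \<in> primitive_dists n G" for x
    using that by (auto simp: primitive_dists_def char_dist_def)
  then show ?thesis by (auto simp: delta_natural_def intro: cInf_greatest)
qed

context
  fixes G :: "('a, 'b) monoid_scheme" and H :: "('c, 'd) monoid_scheme" and h
  assumes h: "h \<in> iso G H"
begin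

private lemma carrier_H: "carrier H = h ` carrier G"
  using h by (auto simp: iso_def bij_betw_def)

private lemma rep_pullback: "representation n H \<rho> \<Longrightarrow> representation n G (\<rho> \<circ> h)"
  using h unfolding representation_def iso_def by (auto intro: hom_compose)

private lemma irreducible_pullback: "irreducible_rep n H \<rho> \<Longrightarrow> irreducible_rep n G (\<rho> \<circ> h)"
  unfolding irreducible_rep_def carrier_H by (simp add: rep_pullback)

private lemma primitive_pullback: "primitive_rep n H \<rho> \<Longrightarrow> primitive_rep n G (\<rho> \<circ> h)"
  using irreducible_pullback[of n \<rho>]
  unfolding primitive_rep_def imprimitive_rep_def carrier_H by simp

private lemma equivalent_pullback:
  "equivalent_reps n G (\<rho> \<circ> h) (\<rho>' \<circ> h) \<longleftrightarrow> equivalent_reps n H \<rho> \<rho>'"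
  unfolding equivalent_reps_def carrier_H by simp

private lemma char_dist_pullback: "char_dist G (\<rho> \<circ> h) (\<rho>' \<circ> h) = char_dist H \<rho> \<rho>'"
proof -
  have inj: "inj_on h (carrier G)" using h by (auto simp: iso_def bij_betw_def)
  let ?A = "{g \<in> carrier G. character (\<rho> \<circ> h) g \<noteq> character (\<rho>' \<circ> h) g}"
  have "{g \<in> carrier H. character \<rho> g \<noteq> character \<rho>' g} = h ` ?A"
    unfolding carrier_H by (auto simp: character_def)
  moreover have "card (h ` ?A) = card ?A"
    by (rule card_image) (rule inj_on_subset[OF inj], auto)
  ultimately show ?thesis
    unfolding char_dist_def Coset.order_def carrier_H by (simp add: card_image[OF inj])
qed

lemma primitive_dists_subset: "primitive_dists n H \<subseteq> primitive_dists n G"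
proof
  fix x assume "x \<in> primitive_dists n H"
  then obtain \<rho> \<rho>' where x: "x = char_dist H \<rho> \<rho>'" and "primitive_rep n H \<rho>"
    "primitive_rep n H \<rho>'" "\<not> equivalent_reps n H \<rho> \<rho>'"
    by (auto simp: primitive_dists_def)
  then have "primitive_rep n G (\<rho> \<circ> h)" "primitive_rep n G (\<rho>' \<circ> h)"
    "\<not> equivalent_reps n G (\<rho> \<circ> h) (\<rho>' \<circ> h)" "x = char_dist G (\<rho> \<circ> h) (\<rho>' \<circ> h)"
    by (simp_all add: primitive_pullback equivalent_pullback char_dist_pullback)
  then show "x \<in> primitive_dists n G" unfolding primitive_dists_def by blast
qed

end

lemma delta_natural_iso:
  assumes "group G" "group H" "h \<in> iso G H"
  shows "delta_natural n G = delta_natural n H"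
  using primitive_dists_subset[OF assms(3)]
    primitive_dists_subset[OF group.iso_set_sym[OF assms(1,3)]]
  unfolding delta_natural_def by (metis subset_antisym)

lemma d_natural_le:
  fixes G :: "('a, 'b) monoid_scheme"
  assumes G: "group G" and fin: "finite (carrier G)"
  shows "d_natural n \<le> delta_natural n G"
proof -
  interpret group G by (rule G)
  obtain f :: "'a \<Rightarrow> nat" where f: "inj_on f (carrier G)"
    using finite_imp_inj_to_nat_seg[OF fin] by blast
  define H :: "nat monoid" where "H = \<lparr>carrier = f ` carrier G,
    monoid.mult = \<lambda>x y. f (inv_into (carrier G) f x \<otimes>\<^bsub>G\<^esub> inv_into (carrier G) f y), one = f \<one>\<^bsub>G\<^esub>\<rparr>"
  have iso: "f \<in> iso G H"
    using f by (auto simp: iso_def hom_def bij_betw_def H_def)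
  have "group (H\<lparr>one := f \<one>\<^bsub>G\<^esub>\<rparr>)"
    using iso_imp_img_group[OF iso] by simp
  then have H: "group H" by (simp add: H_def)
  have "d_natural n \<le> delta_natural n H"
    unfolding d_natural_def
    by (rule cINF_lower) (use H fin in \<open>auto simp: H_def delta_natural_nonneg intro!: bdd_belowI[of _ 0]\<close>)
  also have "\<dots> = delta_natural n G" by (rule delta_natural_iso[OF G H iso, symmetric])
  finally show ?thesis .
qed

end

theory Submission
  imports Defs "HOL-Number_Theory.Residues"
begin

text \<open>
  Let \<open>F\<close> be the field with \<open>q\<close> elements and \<open>\<psi>\<close> a nontrivial additive character of \<open>F\<close>. The group
  \<open>SL\<^sub>2(F)\<close> acts on the complex functions on \<open>F\<close> by the Weil representation, whose matrix coefficients
  are the explicit kernels \<open>weil\<close> below. It commutes with \<open>x \<mapsto> - x\<close>, so it splits into its even part, of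
  dimension \<open>(q + 1) / 2\<close>, and its odd part, of dimension \<open>(q - 1) / 2\<close>. For either parity the two
  representations to compare are those belonging to \<open>\<psi>\<close> and to \<open>x \<mapsto> \<psi> (m * x)\<close>, with \<open>m\<close> a nonsquare.

  \<^item> Irreducibility (\<open>invariant_subspace_trivial\<close>): the upper unipotent matrices act diagonally with
    pairwise distinct characters, so an invariant subspace is spanned by basis vectors, and the lower
    unipotent matrices connect any two basis vectors.

  \<^item> Inequivalence: an intertwining matrix \<open>T\<close> satisfies \<open>T\<^sub>i\<^sub>j = 0\<close> unless \<open>\<beta>\<^sub>j\<close> squared is \<open>m\<close> times
    \<open>\<beta>\<^sub>i\<close> squared, where \<open>\<beta>\<close> enumerates the basis, so each of its rows with \<open>\<beta>\<^sub>i \<noteq> 0\<close> vanishes.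

  \<^item> Distance (\<open>character_rho_generic\<close>): a Gauss sum shows that the character value at a matrix with
    trace different from \<open>2\<close> and \<open>- 2\<close> does not involve \<open>\<psi>\<close>, and neither does the value at a diagonal
    matrix. At most \<open>2 (q\<^sup>2 - 1)\<close> of the \<open>q (q\<^sup>2 - 1)\<close> elements remain.

  \<^item> Primitivity (\<open>primitive_rho\<close>): a system of imprimitivity has at most \<open>(q + 1) / 2\<close> blocks. The upper
    unipotent matrices form a copy of the additive group of \<open>F\<close>, and conjugation by diagonal matrices
    multiplies its elements by squares. If it moved some block, then at least \<open>(q - 1) / 2\<close> nontrivial
    additive characters would be trivial on the stabilizer of some block, and counting these along the
    orbits leaves only the possibility of a single orbit of \<open>(q + 1) / 2\<close> blocks. But \<open>(q + 1) / 2\<close> does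
    not divide \<open>q\<close> (\<open>translation_action_trivial\<close>). So the upper unipotent matrices, and by conjugation the
    lower ones, preserve every block, which contradicts the absence of invariant subspaces.
\<close>

section \<open>Finite fields of prime power order\<close>

context cring
begin

lemma binomial_theorem:
  assumes x: "x \<in> carrier R" and y: "y \<in> carrier R"
  shows "(x \<oplus> y) [^] n = (\<Oplus>k\<in>{..n}. add_pow R (n choose k) (x [^] k \<otimes> y [^] (n - k)))"
proof (induction n)
  case 0
  then show ?case using x y by simp
next
  case (Suc n)
  define T where "T m k = add_pow R (m choose k) (x [^] k \<otimes> y [^] (m - k))" for m k
  have T: "T m k \<in> carrier R" for m k using x y by (simp add: T_def)
  have pascal: "T n k \<otimes> x \<oplus> add_pow R (n choose Suc k) (x [^] Suc k \<otimes> y [^] (n - k)) = T (Suc n) (Suc k)"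
    for k
  proof -
    have "T n k \<otimes> x = add_pow R (n choose k) (x [^] Suc k \<otimes> y [^] (n - k))"
    proof -
      have "x [^] k \<otimes> y [^] (n - k) \<otimes> x = x [^] Suc k \<otimes> y [^] (n - k)"
        using x y by (simp add: m_ac)
      then show ?thesis using x y by (simp add: T_def add_pow_ldistr)
    qed
    then show ?thesis
      using x y by (simp add: T_def add.nat_pow_mult)
  qed
  have "(\<Oplus>k\<in>{..n}. T n k) \<otimes> y = (\<Oplus>k\<in>{..n}. T n k \<otimes> y)"
    using y T by (intro finsum_ldistr) auto
  also have "\<dots> = (\<Oplus>k\<in>{..n}. add_pow R (n choose k) (x [^] k \<otimes> y [^] (Suc n - k)))"
  proof (rule finsum_cong')
    fix k assume "k \<in> {..n}"
    then have "y [^] (Suc n - k) = y [^] (n - k) \<otimes> y" by (simp add: Suc_diff_le)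
    then show "T n k \<otimes> y = add_pow R (n choose k) (x [^] k \<otimes> y [^] (Suc n - k))"
      using x y by (simp add: T_def add_pow_ldistr m_assoc)
  qed (use x y in auto)
  also have "\<dots> = (\<Oplus>k\<in>{..Suc n}. add_pow R (n choose k) (x [^] k \<otimes> y [^] (Suc n - k)))"
    using x y by (subst finsum_Suc) (auto simp: binomial_eq_0)
  also have "\<dots> = (\<Oplus>k\<in>{..n}. add_pow R (n choose Suc k) (x [^] Suc k \<otimes> y [^] (n - k))) \<oplus> T (Suc n) 0"
    using x y by (subst finsum_Suc2) (auto simp: T_def)
  finally have Ty: "(\<Oplus>k\<in>{..n}. T n k) \<otimes> y =
    (\<Oplus>k\<in>{..n}. add_pow R (n choose Suc k) (x [^] Suc k \<otimes> y [^] (n - k))) \<oplus> T (Suc n) 0" .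
  have Tx: "(\<Oplus>k\<in>{..n}. T n k) \<otimes> x = (\<Oplus>k\<in>{..n}. T n k \<otimes> x)"
    using x T by (intro finsum_ldistr) auto
  have S: "(\<Oplus>k\<in>{..n}. T n k) \<in> carrier R" using T by auto
  have "(x \<oplus> y) [^] Suc n = (\<Oplus>k\<in>{..n}. T n k) \<otimes> x \<oplus> (\<Oplus>k\<in>{..n}. T n k) \<otimes> y"
    using Suc.IH x y S by (simp add: T_def r_distr)
  also have "\<dots> = ((\<Oplus>k\<in>{..n}. T n k \<otimes> x) \<oplus>
      (\<Oplus>k\<in>{..n}. add_pow R (n choose Suc k) (x [^] Suc k \<otimes> y [^] (n - k)))) \<oplus> T (Suc n) 0"
    unfolding Tx Ty using x y T by (subst a_assoc) auto
  also have "\<dots> = (\<Oplus>k\<in>{..n}. T (Suc n) (Suc k)) \<oplus> T (Suc n) 0"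
  proof -
    have "(\<Oplus>k\<in>{..n}. T n k \<otimes> x) \<oplus>
        (\<Oplus>k\<in>{..n}. add_pow R (n choose Suc k) (x [^] Suc k \<otimes> y [^] (n - k))) =
      (\<Oplus>k\<in>{..n}. T n k \<otimes> x \<oplus> add_pow R (n choose Suc k) (x [^] Suc k \<otimes> y [^] (n - k)))"
      using x y T by (intro finsum_addf [symmetric]) auto
    then show ?thesis by (simp only: pascal)
  qed
  also have "\<dots> = (\<Oplus>k\<in>{..Suc n}. T (Suc n) k)"
    using T by (subst finsum_Suc2) auto
  finally show ?case by (simp only: T_def)
qed

lemma prime_char_add_pow:
  assumes x: "x \<in> carrier R" and y: "y \<in> carrier R"
    and p: "normalization_semidom_class.prime (p::nat)" and char: "add_pow R p \<one> = \<zero>"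
  shows "(x \<oplus> y) [^] p = x [^] p \<oplus> y [^] p"
proof -
  obtain m where m: "p = Suc (Suc m)"
    using le_Suc_ex[OF prime_ge_2_nat[OF p]] by auto
  define T where "T k = add_pow R (p choose k) (x [^] k \<otimes> y [^] (p - k))" for k
  have T: "T k \<in> carrier R" for k using x y by (simp add: T_def)
  have zero: "T k = \<zero>" if k: "0 < k" "k < p" for k
  proof -
    obtain j where j: "p choose k = p * j"
      using dvd_choose_prime[OF \<open>k < p\<close>] k p by (auto elim: dvdE)
    let ?z = "x [^] k \<otimes> y [^] (p - k)"
    have z: "?z \<in> carrier R" using x y by simp
    have "add_pow R p (add_pow R j ?z) = (add_pow R p \<one>) \<otimes> (add_pow R j ?z)"
      using z by (simp add: add_pow_ldistr)
    also have "\<dots> = \<zero>" using z by (simp add: char)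
    finally show ?thesis
      using z by (simp add: T_def j add.nat_pow_pow mult.commute)
  qed
  have "(x \<oplus> y) [^] p = (\<Oplus>k\<in>{..Suc (Suc m)}. T k)"
    unfolding binomial_theorem[OF x y] T_def m ..
  also have "\<dots> = T p \<oplus> ((\<Oplus>k\<in>{..m}. T (Suc k)) \<oplus> T 0)"
  proof -
    have "(\<Oplus>k\<in>{..Suc (Suc m)}. T k) = T (Suc (Suc m)) \<oplus> (\<Oplus>k\<in>{..Suc m}. T k)"
      using T by (intro finsum_Suc) auto
    moreover have "(\<Oplus>k\<in>{..Suc m}. T k) = (\<Oplus>k\<in>{..m}. T (Suc k)) \<oplus> T 0"
      using T by (intro finsum_Suc2) auto
    ultimately show ?thesis by (simp only: m)
  qed
  also have "(\<Oplus>k\<in>{..m}. T (Suc k)) = \<zero>"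
    proof -
    have "(\<Oplus>k\<in>{..m}. T (Suc k)) = (\<Oplus>k\<in>{..m}. \<zero>)"
      by (rule finsum_cong') (auto simp: zero m)
    then show ?thesis by simp
  qed
  finally show ?thesis using x y by (simp add: T_def)
qed

lemma prime_power_char_add_pow:
  assumes x: "x \<in> carrier R" and y: "y \<in> carrier R"
    and p: "normalization_semidom_class.prime (p::nat)" and char: "add_pow R p \<one> = \<zero>"
  shows "(x \<oplus> y) [^] (p ^ k) = x [^] (p ^ k) \<oplus> y [^] (p ^ k)"
proof (induction k)
  case (Suc k)
  have "z [^] (p ^ Suc k) = (z [^] (p ^ k)) [^] p" if "z \<in> carrier R" for z
    using that by (simp add: nat_pow_pow mult.commute)
  then show ?case using Suc x y by (simp add: prime_char_add_pow[OF _ _ p char])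
qed (use x y in simp)

end


text \<open>
  With \<open>Y = X - a\<close> the polynomial \<open>X\<^sup>q - X\<close> equals \<open>Y\<^sup>q - Y\<close>, by additivity of the Frobenius map; this is
  divisible by \<open>Y\<close> but not by its square.
\<close>

lemma (in domain) count_roots_frobenius_poly_le_1:
  assumes p: "normalization_semidom_class.prime (p::nat)" and char: "add_pow R p \<one> = \<zero>"
    and q: "q = p ^ k" "q > 1"
    and P: "P = X [^]\<^bsub>poly_ring R\<^esub> q \<ominus>\<^bsub>poly_ring R\<^esub> X" and a: "a \<in> carrier R" and root: "a [^] q = a"
    and ne: "P \<noteq> []"
  shows "count (roots P) a \<le> 1"
proof (rule ccontr)
  let ?P = "poly_ring R"
  interpret UP: domain ?P
    by (rule univ_poly_is_domain[OF carrier_is_subring])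
  define Y where "Y = [\<one>, \<ominus> a]"
  define C where "C = poly_of_const a"
  have hom: "ring_hom_ring R ?P poly_of_const"
    using canonical_embedding_ring_hom[OF carrier_is_subring] by simp
  interpret C: ring_hom_ring R ?P poly_of_const by (rule hom)
  have X: "X \<in> carrier ?P" by (rule var_closed(1)[OF carrier_is_subring])
  have Cc: "C \<in> carrier ?P" using a by (simp add: C_def)
  have Y: "Y = X \<ominus>\<^bsub>?P\<^esub> C"
  proof -
    have "\<ominus>\<^bsub>?P\<^esub> C = poly_of_const (\<ominus> a)" using a by (simp add: C_def)
    then show ?thesis
      using a by (simp add: a_minus_def Y_def poly_of_const_def univ_poly_add var_def)
  qed
  have Yc: "Y \<in> carrier ?P" using X Cc by (simp add: Y)
  have charP: "add_pow ?P p \<one>\<^bsub>?P\<^esub> = \<zero>\<^bsub>?P\<^esub>"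
  proof -
    have "poly_of_const (add_pow R n \<one>) = add_pow ?P n \<one>\<^bsub>?P\<^esub>" for n :: nat
      by (induction n) simp_all
    from this[of p] show ?thesis by (simp add: char)
  qed
  have Pc: "P \<in> carrier ?P" using X by (simp add: P)
  have YC: "Y \<oplus>\<^bsub>?P\<^esub> C = X" using X Cc unfolding Y by algebra
  have Cq: "C [^]\<^bsub>?P\<^esub> q = C"
    using a root C.hom_nat_pow[of a q] by (simp add: C_def)
  have "X [^]\<^bsub>?P\<^esub> q = Y [^]\<^bsub>?P\<^esub> q \<oplus>\<^bsub>?P\<^esub> C [^]\<^bsub>?P\<^esub> q"
    using UP.prime_power_char_add_pow[OF Yc Cc p charP, of k] by (simp add: YC q)
  then have "P = (Y [^]\<^bsub>?P\<^esub> q \<oplus>\<^bsub>?P\<^esub> C) \<ominus>\<^bsub>?P\<^esub> (Y \<oplus>\<^bsub>?P\<^esub> C)"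
    by (simp add: P YC Cq)
  also have "\<dots> = Y [^]\<^bsub>?P\<^esub> q \<ominus>\<^bsub>?P\<^esub> Y"
    using Yc Cc UP.nat_pow_closed[OF Yc, of q] by algebra
  finally have PY: "P = Y [^]\<^bsub>?P\<^esub> q \<ominus>\<^bsub>?P\<^esub> Y" .
  assume "\<not> count (roots P) a \<le> 1"
  then have "alg_mult P a \<ge> 2" using alg_mult_eq_count_roots[OF Pc] by simp
  then have "(Y [^]\<^bsub>?P\<^esub> (2::nat)) pdivides P"
    using le_alg_mult_imp_pdivides[OF a Pc, of 2] by (simp add: Y_def)
  then obtain Q where Q: "Q \<in> carrier ?P" "P = Y [^]\<^bsub>?P\<^esub> (2::nat) \<otimes>\<^bsub>?P\<^esub> Q"
    unfolding pdivides_def factor_def by auto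
  obtain r where r: "q = Suc (Suc r)" using less_imp_Suc_add[OF q(2)] by auto
  let ?Z = "Y [^]\<^bsub>?P\<^esub> r"
  have Zc: "?Z \<in> carrier ?P" using Yc by simp
  have "Y \<otimes>\<^bsub>?P\<^esub> (Y \<otimes>\<^bsub>?P\<^esub> ?Z \<ominus>\<^bsub>?P\<^esub> \<one>\<^bsub>?P\<^esub>) = P"
    unfolding PY r UP.nat_pow_Suc using Yc Zc by algebra
  also have "\<dots> = Y \<otimes>\<^bsub>?P\<^esub> (Y \<otimes>\<^bsub>?P\<^esub> Q)"
    unfolding Q(2) using Yc Q(1) by (simp add: numeral_2_eq_2 UP.m_assoc)
  finally have eq: "Y \<otimes>\<^bsub>?P\<^esub> (Y \<otimes>\<^bsub>?P\<^esub> ?Z \<ominus>\<^bsub>?P\<^esub> \<one>\<^bsub>?P\<^esub>) = Y \<otimes>\<^bsub>?P\<^esub> (Y \<otimes>\<^bsub>?P\<^esub> Q)" .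
  have Y0: "Y \<noteq> \<zero>\<^bsub>?P\<^esub>" by (simp add: Y_def univ_poly_zero)
  have "Y \<otimes>\<^bsub>?P\<^esub> ?Z \<ominus>\<^bsub>?P\<^esub> \<one>\<^bsub>?P\<^esub> = Y \<otimes>\<^bsub>?P\<^esub> Q"
    using UP.m_lcancel[OF Y0 Yc] eq Yc Zc Q(1) by auto
  moreover have "\<one>\<^bsub>?P\<^esub> = Y \<otimes>\<^bsub>?P\<^esub> ?Z \<ominus>\<^bsub>?P\<^esub> (Y \<otimes>\<^bsub>?P\<^esub> ?Z \<ominus>\<^bsub>?P\<^esub> \<one>\<^bsub>?P\<^esub>)"
    using Yc Zc by algebra
  moreover have "Y \<otimes>\<^bsub>?P\<^esub> ?Z \<ominus>\<^bsub>?P\<^esub> Y \<otimes>\<^bsub>?P\<^esub> Q = Y \<otimes>\<^bsub>?P\<^esub> (?Z \<ominus>\<^bsub>?P\<^esub> Q)"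
    using Yc Zc Q(1) by algebra
  ultimately have one: "\<one>\<^bsub>?P\<^esub> = Y \<otimes>\<^bsub>?P\<^esub> (?Z \<ominus>\<^bsub>?P\<^esub> Q)"
    by simp
  have "eval Y a = \<zero>" using a by (simp add: Y_def r_neg)
  moreover have "eval \<one>\<^bsub>?P\<^esub> a = eval Y a \<otimes> eval (?Z \<ominus>\<^bsub>?P\<^esub> Q) a"
    unfolding one using ring_hom_memE(2)[OF eval_is_hom[OF carrier_is_subring a] Yc] Zc Q(1) by simp
  moreover have "eval (?Z \<ominus>\<^bsub>?P\<^esub> Q) a \<in> carrier R"
    using ring_hom_memE(1)[OF eval_is_hom[OF carrier_is_subring a]] Zc Q(1) by simp
  moreover have "eval \<one>\<^bsub>?P\<^esub> a = \<one>" using a by (simp add: univ_poly_one)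
  ultimately show False by simp
qed

text \<open>
  All roots of \<open>X\<^sup>q - X\<close> are simple, so there are as many of them as the degree says.
\<close>

lemma (in algebraically_closed) card_frobenius_fixed:
  assumes p: "normalization_semidom_class.prime (p::nat)" and char: "add_pow L p \<one> = \<zero>"
    and q: "q = p ^ k" "q > 1"
  shows "card {x \<in> carrier L. x [^] q = x} = q"
proof -
  let ?P = "poly_ring L"
  interpret UP: domain ?P
    by (rule univ_poly_is_domain[OF carrier_is_subring])
  define P where P: "P = X [^]\<^bsub>?P\<^esub> q \<ominus>\<^bsub>?P\<^esub> X"
  have X: "X \<in> carrier ?P" by (rule var_closed(1)[OF carrier_is_subring])
  have Pc: "P \<in> carrier ?P" using X by (simp add: P)
  have deg: "degree P = q"
  proof -
    have mon: "X [^]\<^bsub>?P\<^esub> q = monom \<one> q"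
      by (rule unitary_monom_eq_var_pow[OF carrier_is_subring, symmetric])
    have m: "\<ominus>\<^bsub>?P\<^esub> X = [\<ominus> \<one>, \<zero>]"
      using univ_poly_a_inv_def'[OF carrier_is_subring X] by (simp add: var_def)
    have "polynomial (carrier L) (monom \<one> q)" "polynomial (carrier L) [\<ominus> \<one>, \<zero>]"
      by (auto simp: polynomial_def monom_def)
    then show ?thesis
      using poly_add_degree_eq[OF carrier_is_subring, of "monom \<one> q" "[\<ominus> \<one>, \<zero>]"] q(2)
      unfolding P a_minus_def mon m univ_poly_add by (simp add: monom_def del: poly_add.simps)
  qed
  have ev: "eval P x = x [^] q \<ominus> x" if x: "x \<in> carrier L" for x
  proof -
    interpret E: ring_hom_ring ?P L "\<lambda>p. eval p x"
      using eval_ring_hom[OF carrier_is_subring x] .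
    show ?thesis using X x E.hom_nat_pow[OF X, of q] by (simp add: P a_minus_def eval_var)
  qed
  have ne: "P \<noteq> []" using deg q(2) by auto
  have root: "is_root P x \<longleftrightarrow> x \<in> carrier L \<and> x [^] q = x" for x
    using ne unfolding is_root_def by (auto simp: ev r_right_minus_eq)
  have "set_mset (roots P) = {x \<in> carrier L. x [^] q = x}"
    using roots_mem_iff_is_root[OF Pc] root by auto
  moreover have "count (roots P) x = 1" if "x \<in># roots P" for x
  proof -
    have "x \<in> carrier L" "x [^] q = x"
      using that roots_mem_iff_is_root[OF Pc] root by auto
    then have "count (roots P) x \<le> 1"
      using count_roots_frobenius_poly_le_1[OF p char q P _ _ ne] by simp
    moreover have "count (roots P) x > 0" using that by simp
    ultimately show ?thesis by linarith
  qed
  then have "size (roots P) = card (set_mset (roots P))"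
    by (simp add: size_multiset_overloaded_eq)
  moreover have "size (roots P) = q"
    using roots_over_carrier[OF Pc] deg by (simp add: splitted_def)
  ultimately show ?thesis by simp
qed


lemma exists_field_prime_power:
  assumes p: "normalization_semidom_class.prime (p::nat)" and q: "q = p ^ k" "q > 1"
  obtains K :: "((int list \<times> nat) multiset \<Rightarrow> int) ring" where
    "field K" "finite (carrier K)" "card (carrier K) = q" "add_pow K p \<one>\<^bsub>K\<^esub> = \<zero>\<^bsub>K\<^esub>"
proof -
  define R where "R = residue_ring (int p)"
  interpret R: residues_prime p R
    using p by unfold_locales (simp_all add: R_def)
  obtain L :: "((int list \<times> nat) multiset \<Rightarrow> int) ring" where
    L: "algebraic_closure L (R.indexed_const ` carrier R)" and hom: "R.indexed_const \<in> Ring.ring_hom R L"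
    using R.exists_closure by blast
  interpret L: algebraic_closure L "R.indexed_const ` carrier R" by (rule L)
  interpret h: ring_hom_ring R L R.indexed_const
    by (rule ring_hom_ringI2[OF R.ring_axioms L.ring_axioms hom])
  have "R.indexed_const (add_pow R n \<one>\<^bsub>R\<^esub>) = add_pow L n \<one>\<^bsub>L\<^esub>" for n :: nat
    by (induction n) simp_all
  moreover have "add_pow R n \<one>\<^bsub>R\<^esub> = int n mod int p" for n :: nat
    by (induction n) (simp_all add: R.res_add_eq R.res_one_eq R.res_zero_eq mod_simps add.commute)
  ultimately have char: "add_pow L p \<one>\<^bsub>L\<^esub> = \<zero>\<^bsub>L\<^esub>"
    using h.hom_zero by (metis R.res_zero_eq mod_self)
  define S where "S = {x \<in> carrier L. x [^]\<^bsub>L\<^esub> q = x}"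
  have card: "card S = q"
    unfolding S_def by (rule L.card_frobenius_fixed[OF p char q])
  have add: "(x \<oplus>\<^bsub>L\<^esub> y) [^]\<^bsub>L\<^esub> q = x [^]\<^bsub>L\<^esub> q \<oplus>\<^bsub>L\<^esub> y [^]\<^bsub>L\<^esub> q"
    if "x \<in> carrier L" "y \<in> carrier L" for x y
    using L.prime_power_char_add_pow[OF that p char] q by simp
  have "subring S L"
  proof (rule L.subringI)
    fix x assume x: "x \<in> S"
    have "(\<ominus>\<^bsub>L\<^esub> x) [^]\<^bsub>L\<^esub> q \<oplus>\<^bsub>L\<^esub> x = \<zero>\<^bsub>L\<^esub>"
      using add[of "\<ominus>\<^bsub>L\<^esub> x" x] x q(2) by (simp add: S_def L.l_neg L.nat_pow_zero)
    then have "(\<ominus>\<^bsub>L\<^esub> x) [^]\<^bsub>L\<^esub> q = \<ominus>\<^bsub>L\<^esub> x"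
      using x by (intro L.minus_equality[symmetric]) (auto simp: S_def)
    then show "\<ominus>\<^bsub>L\<^esub> x \<in> S" using x by (simp add: S_def)
  qed (auto simp: S_def add L.nat_pow_distrib)
  moreover have "inv\<^bsub>L\<^esub> x \<in> S" if "x \<in> S - {\<zero>\<^bsub>L\<^esub>}" for x
  proof -
    have x: "x \<in> Units L" "x [^]\<^bsub>L\<^esub> q = x" using that by (auto simp: S_def L.field_Units)
    have "x \<otimes>\<^bsub>L\<^esub> (inv\<^bsub>L\<^esub> x) [^]\<^bsub>L\<^esub> q = x [^]\<^bsub>L\<^esub> q \<otimes>\<^bsub>L\<^esub> (inv\<^bsub>L\<^esub> x) [^]\<^bsub>L\<^esub> q"
      by (simp only: x(2))
    also have "\<dots> = (x \<otimes>\<^bsub>L\<^esub> inv\<^bsub>L\<^esub> x) [^]\<^bsub>L\<^esub> q"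
      using x by (intro L.nat_pow_distrib[symmetric]) (auto simp: L.Units_closed)
    also have "\<dots> = \<one>\<^bsub>L\<^esub>" using x by simp
    finally have "inv\<^bsub>L\<^esub> x = (inv\<^bsub>L\<^esub> x) [^]\<^bsub>L\<^esub> q"
      using x by (intro L.comm_inv_char) (auto simp: L.Units_closed)
    then show ?thesis using x by (simp add: S_def)
  qed
  ultimately have "subfield S L" by (rule L.subfieldI')
  then have "field (L\<lparr>carrier := S\<rparr>)" by (rule L.subfield_iff)
  moreover have "finite S" using card q(2) card.infinite by fastforce
  moreover have "add_pow (L\<lparr>carrier := S\<rparr>) n \<one>\<^bsub>L\<^esub> = add_pow L n \<one>\<^bsub>L\<^esub>" for n :: nat
    by (simp add: add_pow_def nat_pow_def)
  ultimately show thesis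
    using card char by (intro that[of "L\<lparr>carrier := S\<rparr>"]) auto
qed


text \<open>
  A field of order \<open>q\<close> for every odd prime power \<open>q\<close>; for other \<open>q\<close> merely some commutative ring. All of
  them have carriers in one type, the one that holds the algebraic closures of the integers modulo primes.
\<close>

definition galois_field :: "nat \<Rightarrow> ((int list \<times> nat) multiset \<Rightarrow> int) ring" where
  "galois_field q = (SOME K. cring K \<and> (primepow q \<and> odd q \<longrightarrow>
     field K \<and> finite (carrier K) \<and> card (carrier K) = q \<and> \<one>\<^bsub>K\<^esub> \<oplus>\<^bsub>K\<^esub> \<one>\<^bsub>K\<^esub> \<noteq> \<zero>\<^bsub>K\<^esub>))"

lemma galois_field_spec:
  "cring (galois_field q) \<and> (primepow q \<and> odd q \<longrightarrow>
     field (galois_field q) \<and> finite (carrier (galois_field q)) \<and> card (carrier (galois_field q)) = q \<and>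
     \<one>\<^bsub>galois_field q\<^esub> \<oplus>\<^bsub>galois_field q\<^esub> \<one>\<^bsub>galois_field q\<^esub> \<noteq> \<zero>\<^bsub>galois_field q\<^esub>)"
  unfolding galois_field_def
proof (rule someI_ex, cases "primepow q \<and> odd q")
  case True
  then obtain p k where p: "normalization_semidom_class.prime p" and k: "k > 0" and q: "q = p ^ k"
    unfolding primepow_def by blast
  have q1: "q > 1" using one_less_power[OF prime_gt_1_nat[OF p] k] by (simp add: q)
  obtain K :: "((int list \<times> nat) multiset \<Rightarrow> int) ring" where
    K: "field K" "finite (carrier K)" "card (carrier K) = q" "add_pow K p \<one>\<^bsub>K\<^esub> = \<zero>\<^bsub>K\<^esub>"
    using exists_field_prime_power[OF p q q1] by blast
  interpret K: field K by (rule K)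
  have "\<one>\<^bsub>K\<^esub> \<oplus>\<^bsub>K\<^esub> \<one>\<^bsub>K\<^esub> \<noteq> \<zero>\<^bsub>K\<^esub>"
  proof
    assume two: "\<one>\<^bsub>K\<^esub> \<oplus>\<^bsub>K\<^esub> \<one>\<^bsub>K\<^esub> = \<zero>\<^bsub>K\<^esub>"
    have "odd p" using True q k by auto
    then obtain m where m: "p = Suc (m + m)" by (metis oddE mult_2 Suc_eq_plus1)
    have "add_pow K (j + j) \<one>\<^bsub>K\<^esub> = \<zero>\<^bsub>K\<^esub>" for j :: nat
      by (induction j) (simp_all add: K.a_assoc two)
    from this[of m] show False using K(4) by (simp add: m)
  qed
  then show "\<exists>K :: ((int list \<times> nat) multiset \<Rightarrow> int) ring. cring K \<and> (primepow q \<and> odd q \<longrightarrow>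
     field K \<and> finite (carrier K) \<and> card (carrier K) = q \<and> \<one>\<^bsub>K\<^esub> \<oplus>\<^bsub>K\<^esub> \<one>\<^bsub>K\<^esub> \<noteq> \<zero>\<^bsub>K\<^esub>)"
    using K K.cring_axioms by blast
next
  case False
  obtain K :: "((int list \<times> nat) multiset \<Rightarrow> int) ring" where "field K"
    using exists_field_prime_power[of 2 2 1] by (auto simp: two_is_prime_nat)
  then have "cring K" by (simp add: domain_def field_def)
  with False show "\<exists>K :: ((int list \<times> nat) multiset \<Rightarrow> int) ring. cring K \<and> (primepow q \<and> odd q \<longrightarrow>
     field K \<and> finite (carrier K) \<and> card (carrier K) = q \<and> \<one>\<^bsub>K\<^esub> \<oplus>\<^bsub>K\<^esub> \<one>\<^bsub>K\<^esub> \<noteq> \<zero>\<^bsub>K\<^esub>)"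
    by blast
qed

interpretation galois_field: cring "galois_field q" for q
  using galois_field_spec by blast

text \<open>
  The product of the rings \<open>galois_field q\<close> over all natural numbers \<open>q\<close>. As a type of class
  \<^class>\<open>comm_ring\<close> it contains, for every odd prime power \<open>q\<close>, the field of order \<open>q\<close> as a subset that is
  closed under the ring operations. Identities in that field are thereby identities in a type of class
  \<^class>\<open>comm_ring\<close>, although the order \<open>q\<close> is a variable and cannot be built into a type.
\<close>

typedef galois_product = "{f. \<forall>q. f q \<in> carrier (galois_field q)}"
  by (rule exI[of _ "\<lambda>q. \<zero>\<^bsub>galois_field q\<^esub>"]) simp

setup_lifting type_definition_galois_product

instantiation galois_product :: comm_ring
begin

lift_definition zero_galois_product :: galois_product is "\<lambda>q. \<zero>\<^bsub>galois_field q\<^esub>" by simp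

lift_definition plus_galois_product :: "galois_product \<Rightarrow> galois_product \<Rightarrow> galois_product"
  is "\<lambda>f g q. f q \<oplus>\<^bsub>galois_field q\<^esub> g q" by simp

lift_definition minus_galois_product :: "galois_product \<Rightarrow> galois_product \<Rightarrow> galois_product"
  is "\<lambda>f g q. f q \<ominus>\<^bsub>galois_field q\<^esub> g q" by simp

lift_definition uminus_galois_product :: "galois_product \<Rightarrow> galois_product"
  is "\<lambda>f q. \<ominus>\<^bsub>galois_field q\<^esub> f q" by simp

lift_definition times_galois_product :: "galois_product \<Rightarrow> galois_product \<Rightarrow> galois_product"
  is "\<lambda>f g q. f q \<otimes>\<^bsub>galois_field q\<^esub> g q" by simp

instance
proof
  fix a b c :: galois_product
  show "a + b + c = a + (b + c)" by transfer (simp add: galois_field.a_assoc)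
  show "a + b = b + a" by transfer (simp add: galois_field.a_comm)
  show "0 + a = a" by transfer simp
  show "- a + a = 0" by transfer (simp add: galois_field.l_neg)
  show "a - b = a + - b" by transfer (simp add: galois_field.minus_eq)
  show "a * b * c = a * (b * c)" by transfer (simp add: galois_field.m_assoc)
  show "a * b = b * a" by transfer (simp add: galois_field.m_comm)
  show "(a + b) * c = a * c + b * c" by transfer (simp add: galois_field.l_distr)
qed

end

text \<open>
  A finite field of odd characteristic, embedded in a commutative ring type as a subset \<open>F\<close> with its own unit element \<open>e\<close>. The ambient ring need not have a unit, and \<open>e\<close> acts
  as a unit on \<open>F\<close> only.
\<close>

locale odd_finite_field =
  fixes F :: "'a::comm_ring set" and e :: 'a
  assumes finite_F [simp]: "finite F"
    and zero_mem [simp]: "0 \<in> F"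
    and e_mem [simp]: "e \<in> F"
    and add_mem [simp]: "x \<in> F \<Longrightarrow> y \<in> F \<Longrightarrow> x + y \<in> F"
    and uminus_mem [simp]: "x \<in> F \<Longrightarrow> - x \<in> F"
    and mult_mem [simp]: "x \<in> F \<Longrightarrow> y \<in> F \<Longrightarrow> x * y \<in> F"
    and mult_e [simp]: "x \<in> F \<Longrightarrow> x * e = x"
    and e_plus_e: "e + e \<noteq> 0"
    and inverse_exists: "x \<in> F \<Longrightarrow> x \<noteq> 0 \<Longrightarrow> \<exists>y\<in>F. x * y = e"

theorem exists_odd_finite_field:
  assumes q: "primepow q" "odd q"
  obtains F and e :: galois_product where "odd_finite_field F e" "card F = q"
proof -
  let ?K = "galois_field q"
  have K: "field ?K" "finite (carrier ?K)" "card (carrier ?K) = q" "\<one>\<^bsub>?K\<^esub> \<oplus>\<^bsub>?K\<^esub> \<one>\<^bsub>?K\<^esub> \<noteq> \<zero>\<^bsub>?K\<^esub>"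
    using galois_field_spec[of q] q by auto
  interpret K: field ?K by (rule K)
  \<comment> \<open>the embedding of the factor with index \<open>q\<close>\<close>
  define \<iota> where "\<iota> x = Abs_galois_product (\<lambda>r. if r = q then x else \<zero>\<^bsub>galois_field r\<^esub>)" for x
  have rep: "Rep_galois_product (\<iota> x) = (\<lambda>r. if r = q then x else \<zero>\<^bsub>galois_field r\<^esub>)"
    if "x \<in> carrier ?K" for x
    unfolding \<iota>_def using that by (subst Abs_galois_product_inverse) auto
  have inj: "\<iota> x = \<iota> y \<longleftrightarrow> x = y" if "x \<in> carrier ?K" "y \<in> carrier ?K" for x y
    using rep[OF that(1)] rep[OF that(2)] by metis
  have zero: "\<iota> \<zero>\<^bsub>?K\<^esub> = 0"
    by (simp add: Rep_galois_product_inject[symmetric] rep zero_galois_product.rep_eq fun_eq_iff)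
  have add: "\<iota> x + \<iota> y = \<iota> (x \<oplus>\<^bsub>?K\<^esub> y)" if "x \<in> carrier ?K" "y \<in> carrier ?K" for x y
    using that
    by (simp add: Rep_galois_product_inject[symmetric] rep plus_galois_product.rep_eq fun_eq_iff)
  have uminus: "- \<iota> x = \<iota> (\<ominus>\<^bsub>?K\<^esub> x)" if "x \<in> carrier ?K" for x
    using that
    by (simp add: Rep_galois_product_inject[symmetric] rep uminus_galois_product.rep_eq fun_eq_iff)
  have mult: "\<iota> x * \<iota> y = \<iota> (x \<otimes>\<^bsub>?K\<^esub> y)" if "x \<in> carrier ?K" "y \<in> carrier ?K" for x y
    using that
    by (simp add: Rep_galois_product_inject[symmetric] rep times_galois_product.rep_eq fun_eq_iff)
  have "odd_finite_field (\<iota> ` carrier ?K) (\<iota> \<one>\<^bsub>?K\<^esub>)"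
  proof
    show "\<iota> \<one>\<^bsub>?K\<^esub> + \<iota> \<one>\<^bsub>?K\<^esub> \<noteq> 0" using K(4) by (simp add: add inj flip: zero)
    show "\<exists>y\<in>\<iota> ` carrier ?K. x * y = \<iota> \<one>\<^bsub>?K\<^esub>" if x: "x \<in> \<iota> ` carrier ?K" "x \<noteq> 0" for x
    proof -
      obtain u where u: "u \<in> carrier ?K" "x = \<iota> u" using x by blast
      then have "u \<in> Units ?K" using x(2) zero by (auto simp: K.field_Units)
      then have "x * \<iota> (inv\<^bsub>?K\<^esub> u) = \<iota> \<one>\<^bsub>?K\<^esub>" "inv\<^bsub>?K\<^esub> u \<in> carrier ?K"
        using u by (simp_all add: mult)
      then show ?thesis by blast
    qed
    show "0 \<in> \<iota> ` carrier ?K" unfolding zero[symmetric] by simp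
  qed (use K(2) in \<open>auto simp: add uminus mult\<close>)
  moreover have "card (\<iota> ` carrier ?K) = q"
    using K(3) by (subst card_image) (auto simp: inj_on_def inj)
  ultimately show thesis by (rule that)
qed

section \<open>Squares and the quadratic character\<close>

context odd_finite_field
begin

lemma e_mult [simp]: "x \<in> F \<Longrightarrow> e * x = x"
  by (simp add: mult.commute[of e])

lemma diff_mem [simp]: "x \<in> F \<Longrightarrow> y \<in> F \<Longrightarrow> x - y \<in> F"
  using add_mem[of x "- y"] by simp

lemma e_nonzero [simp]: "e \<noteq> 0"
  using e_plus_e by auto

text \<open>The inverse in \<open>F\<close>; unspecified at \<open>0\<close> and outside \<open>F\<close>.\<close>

definition finv :: "'a \<Rightarrow> 'a" where
  "finv x = (SOME y. y \<in> F \<and> x * y = e)"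

lemma finv:
  assumes "x \<in> F" "x \<noteq> 0"
  shows finv_mem [simp]: "finv x \<in> F" and mult_finv [simp]: "x * finv x = e"
    and finv_mult [simp]: "finv x * x = e" and finv_nonzero [simp]: "finv x \<noteq> 0"
proof -
  have *: "finv x \<in> F \<and> x * finv x = e"
    unfolding finv_def by (rule someI_ex) (use inverse_exists[OF assms] in blast)
  then show "finv x \<in> F" "x * finv x = e" by auto
  then show "finv x * x = e" by (simp add: mult.commute)
  show "finv x \<noteq> 0" using * by auto
qed

lemma finv_mult_left [simp]: "x \<in> F \<Longrightarrow> x \<noteq> 0 \<Longrightarrow> y \<in> F \<Longrightarrow> finv x * (x * y) = y"
  by (simp flip: mult.assoc)

lemma mult_finv_left [simp]: "x \<in> F \<Longrightarrow> x \<noteq> 0 \<Longrightarrow> y \<in> F \<Longrightarrow> x * (finv x * y) = y"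
  by (simp flip: mult.assoc)

lemma mult_eq_zero [simp]: "x \<in> F \<Longrightarrow> y \<in> F \<Longrightarrow> x * y = 0 \<longleftrightarrow> x = 0 \<or> y = 0"
  using finv_mult_left[of x y] by (metis mult_zero_left mult_zero_right)

lemma mult_left_cancel: "c \<in> F \<Longrightarrow> c \<noteq> 0 \<Longrightarrow> x \<in> F \<Longrightarrow> y \<in> F \<Longrightarrow> c * x = c * y \<longleftrightarrow> x = y"
  using finv_mult_left[of c x] finv_mult_left[of c y] by metis

lemma finv_unique: "x \<in> F \<Longrightarrow> y \<in> F \<Longrightarrow> x * y = e \<Longrightarrow> finv x = y"
  by (metis e_nonzero finv_mem mult_eq_zero mult_finv mult_left_cancel)

lemma add_self_eq_zero [simp]: "x \<in> F \<Longrightarrow> x + x = 0 \<longleftrightarrow> x = 0"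
  using mult_eq_zero[of x "e + e"] e_plus_e by (simp add: distrib_left)

lemma uminus_eq_self [simp]: "x \<in> F \<Longrightarrow> - x = x \<longleftrightarrow> x = 0"
  using add_self_eq_zero[of x] by (metis add.right_inverse neg_equal_0_iff_equal)

lemma square_eq_square:
  assumes "x \<in> F" "y \<in> F"
  shows "x * x = y * y \<longleftrightarrow> x = y \<or> x = - y"
proof -
  have "x * x - y * y = (x - y) * (x + y)" by (simp add: algebra_simps)
  then show ?thesis
    using mult_eq_zero[of "x - y" "x + y"] assms by (auto simp: eq_neg_iff_add_eq_0)
qed

lemma sum_translate:
  assumes "c \<in> F"
  shows "(\<Sum>x\<in>F. f (x + c)) = (\<Sum>x\<in>F. f x)"
  by (rule sum.reindex_bij_witness[of _ "\<lambda>x. x - c" "\<lambda>x. x + c"]) (use assms in auto)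

lemma sum_scale:
  assumes "c \<in> F" "c \<noteq> 0"
  shows "(\<Sum>x\<in>F. f (c * x)) = (\<Sum>x\<in>F. f x)"
  by (rule sum.reindex_bij_witness[of _ "\<lambda>x. finv c * x" "\<lambda>x. c * x"]) (use assms in auto)

lemma sum_uminus: "(\<Sum>x\<in>F. f (- x)) = (\<Sum>x\<in>F. f x)"
  by (rule sum.reindex_bij_witness[of _ uminus uminus]) auto

text \<open>The nonzero squares of \<open>F\<close>.\<close>

definition squares :: "'a set" where
  "squares = (\<lambda>x. x * x) ` (F - {0})"

text \<open>
  A set of representatives of the nonzero elements of \<open>F\<close> modulo sign: one square root is chosen for every
  nonzero square.
\<close>

definition half :: "'a set" where
  "half = (\<lambda>t. SOME x. x \<in> F \<and> x * x = t) ` squares"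

lemma squares_subset: "squares \<subseteq> F - {0}"
  by (auto simp: squares_def)

lemma finite_squares [simp]: "finite squares"
  by (simp add: squares_def)

lemma root_square:
  assumes "t \<in> squares"
  defines "r \<equiv> SOME x. x \<in> F \<and> x * x = t"
  shows "r \<in> F" "r * r = t"
proof -
  have "r \<in> F \<and> r * r = t"
    unfolding r_def by (rule someI_ex) (use assms in \<open>auto simp: squares_def\<close>)
  then show "r \<in> F" "r * r = t" by auto
qed

lemma finite_half [simp]: "finite half"
  by (simp add: half_def)

lemma half_subset: "half \<subseteq> F - {0}"
  using root_square squares_subset unfolding half_def by force

lemma inj_on_square_half: "inj_on (\<lambda>x. x * x) half"
  unfolding half_def by (auto intro!: inj_onI simp: root_square)

lemma square_half: "(\<lambda>x. x * x) ` half = squares"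
  unfolding half_def by (force simp: root_square image_image)

lemma half_nonempty [simp]: "half \<noteq> {}"
proof -
  have "e * e \<in> squares" unfolding squares_def by (rule image_eqI[of _ _ e]) auto
  then show ?thesis using square_half by blast
qed

lemma card_half: "card half = card squares"
  using card_image[OF inj_on_square_half] by (simp add: square_half)

lemma half_cases:
  assumes "x \<in> F" "x \<noteq> 0"
  shows "x \<in> half \<longleftrightarrow> - x \<notin> half"
proof
  have nx: "- x \<noteq> x" using assms by simp
  assume "x \<in> half"
  then show "- x \<notin> half"
    using inj_onD[OF inj_on_square_half, of x "- x"] nx by auto
next
  assume n: "- x \<notin> half"
  have "x * x \<in> (\<lambda>x. x * x) ` half" using assms unfolding square_half by (auto simp: squares_def)
  then obtain y where y: "y \<in> half" "x * x = y * y" by auto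
  then have "x = y \<or> x = - y" using square_eq_square[of x y] assms half_subset by auto
  with y n show "x \<in> half" by auto
qed

lemma F_half: "F = {0} \<union> half \<union> uminus ` half"
proof
  show "F \<subseteq> {0} \<union> half \<union> uminus ` half"
  proof
    fix x assume x: "x \<in> F"
    have "x \<in> uminus ` half" if "- x \<in> half" using image_eqI[of x uminus "- x"] that by simp
    then show "x \<in> {0} \<union> half \<union> uminus ` half" using half_cases[OF x] by auto
  qed
  show "{0} \<union> half \<union> uminus ` half \<subseteq> F" using half_subset by auto
qed

lemma half_disjoint: "half \<inter> uminus ` half = {}"
  using half_cases half_subset by fastforce

lemma sum_even:
  fixes f :: "'a \<Rightarrow> complex"
  assumes "\<And>x. x \<in> F \<Longrightarrow> f (- x) = f x"
  shows "(\<Sum>x\<in>F. f x) = f 0 + 2 * (\<Sum>x\<in>half. f x)"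
proof -
  have "(\<Sum>x\<in>F. f x) = (\<Sum>x\<in>{0} \<union> (half \<union> uminus ` half). f x)"
    by (subst F_half) (simp add: Un_assoc)
  also have "\<dots> = f 0 + (\<Sum>x\<in>half \<union> uminus ` half. f x)"
    by (subst sum.union_disjoint) (use half_subset in auto)
  also have "(\<Sum>x\<in>half \<union> uminus ` half. f x) = (\<Sum>x\<in>half. f x) + (\<Sum>x\<in>uminus ` half. f x)"
    by (subst sum.union_disjoint) (use half_disjoint in auto)
  also have "(\<Sum>x\<in>uminus ` half. f x) = (\<Sum>x\<in>half. f (- x))"
    by (subst sum.reindex) (auto intro: inj_onI)
  also have "\<dots> = (\<Sum>x\<in>half. f x)"
    by (rule sum.cong) (use assms half_subset in auto)
  finally show ?thesis by simp
qed

lemma card_F: "card F = 2 * card half + 1"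
proof -
  have "(\<Sum>x\<in>F. 1 :: complex) = 1 + 2 * (\<Sum>x\<in>half. 1)"
    by (rule sum_even) simp
  then have "complex_of_nat (card F) = of_nat (2 * card half + 1)" by simp
  then show ?thesis by (simp only: of_nat_eq_iff)
qed

text \<open>
  The quadratic character of \<open>F\<close>. It is only used at nonzero arguments; at \<open>0\<close> it takes the value \<open>- 1\<close>.
\<close>

definition qchar :: "'a \<Rightarrow> complex" where
  "qchar t = (if t \<in> squares then 1 else - 1)"

lemma qchar_nonzero [simp]: "qchar t \<noteq> 0"
  and qchar_square [simp]: "qchar t * qchar t = 1"
  by (simp_all add: qchar_def)

lemma e_square [simp]: "e \<in> squares"
  unfolding squares_def by (rule image_eqI[of _ _ e]) auto

lemma square_mult_squares:
  assumes "s \<in> squares" "t \<in> F"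
  shows "s * t \<in> squares \<longleftrightarrow> t \<in> squares"
proof
  obtain x where x: "x \<in> F" "x \<noteq> 0" "s = x * x" using assms by (auto simp: squares_def)
  show "s * t \<in> squares" if t: "t \<in> squares"
  proof -
    obtain y where y: "y \<in> F" "y \<noteq> 0" "t = y * y" using t by (auto simp: squares_def)
    have "s * t = (x * y) * (x * y)" using x y by (simp add: mult_ac)
    then show ?thesis using x y by (auto simp: squares_def)
  qed
  show "t \<in> squares" if st: "s * t \<in> squares"
  proof -
    obtain y where y: "y \<in> F" "y \<noteq> 0" "s * t = y * y" using st by (auto simp: squares_def)
    have "(finv x * y) * (finv x * y) = finv x * finv x * (s * t)"
      by (simp add: y(3) mult_ac)
    also have "\<dots> = (finv x * x) * (finv x * x) * t" by (simp only: x(3) mult_ac)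
    also have "\<dots> = t" using x assms by simp
    finally show ?thesis
      unfolding squares_def using x y by (intro image_eqI[of _ _ "finv x * y"]) auto
  qed
qed

lemma nonsquare_cover:
  assumes n: "n \<in> F" "n \<noteq> 0" "n \<notin> squares"
  shows "F - {0} = squares \<union> (\<lambda>s. n * s) ` squares" "squares \<inter> (\<lambda>s. n * s) ` squares = {}"
proof -
  show disj: "squares \<inter> (\<lambda>s. n * s) ` squares = {}"
    using square_mult_squares[OF _ n(1)] n squares_subset by (auto simp: mult.commute)
  have "card ((\<lambda>s. n * s) ` squares) = card squares"
    using mult_left_cancel[OF n(1,2)] squares_subset by (intro card_image inj_onI) blast
  then have "card (squares \<union> (\<lambda>s. n * s) ` squares) = 2 * card squares"
    using disj by (simp add: card_Un_disjoint)
  also have "\<dots> = card (F - {0})" using card_F by (simp add: card_half)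
  finally show "F - {0} = squares \<union> (\<lambda>s. n * s) ` squares"
    using n squares_subset by (intro card_subset_eq[symmetric]) auto
qed

lemma qchar_mult:
  assumes "s \<in> F" "s \<noteq> 0" "t \<in> F" "t \<noteq> 0"
  shows "qchar (s * t) = qchar s * qchar t"
proof (cases "s \<in> squares")
  case True
  then show ?thesis using square_mult_squares[OF True] assms by (simp add: qchar_def)
next
  case s: False
  show ?thesis
  proof (cases "t \<in> squares")
    case True
    then show ?thesis
      using square_mult_squares[OF True, of s] assms s by (simp add: qchar_def mult.commute)
  next
    case False
    then obtain r where r: "r \<in> squares" "t = s * r"
      using nonsquare_cover(1)[OF assms(1,2) s] assms by blast
    have "s * s \<in> squares" using assms by (auto simp: squares_def)
    then have "s * t \<in> squares"
      using square_mult_squares[of "s * s" r] r squares_subset by (auto simp: mult.assoc)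
    then show ?thesis using s False by (simp add: qchar_def)
  qed
qed

lemma qchar_e [simp]: "qchar e = 1"
  by (simp add: qchar_def)

lemma qchar_inverse:
  assumes "s \<in> F" "t \<in> F" "s * t = e"
  shows "qchar s = qchar t"
proof -
  have "s \<noteq> 0" "t \<noteq> 0" using assms by auto
  then have "qchar s * qchar t = 1" using assms qchar_mult[of s t] by simp
  then show ?thesis by (auto simp: qchar_def split: if_splits)
qed

lemma qchar_finv [simp]: "s \<in> F \<Longrightarrow> s \<noteq> 0 \<Longrightarrow> qchar (finv s) = qchar s"
  by (rule qchar_inverse) auto

lemma exists_nonsquare: "\<exists>n\<in>F. n \<noteq> 0 \<and> n \<notin> squares"
proof (rule ccontr)
  assume "\<not> ?thesis"
  then have "squares = F - {0}" using squares_subset by auto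
  then have "card F - 1 = card half" using card_half by simp
  moreover have "card half > 0" by (simp add: card_gt_0_iff)
  ultimately show False using card_F by simp
qed

end

section \<open>Additive characters and Gauss sums\<close>

locale additive_character = odd_finite_field F e for F :: "'a::comm_ring set" and e +
  fixes \<psi> :: "'a \<Rightarrow> complex"
    \<comment> \<open>the normalization at \<open>0\<close> only excludes the zero function\<close>
  assumes psi_zero [simp]: "\<psi> 0 = 1"
    and psi_add: "x \<in> F \<Longrightarrow> y \<in> F \<Longrightarrow> \<psi> (x + y) = \<psi> x * \<psi> y"
    and psi_nontrivial: "\<exists>u\<in>F. \<psi> u \<noteq> 1"
begin

lemma psi_uminus_mult [simp]: "x \<in> F \<Longrightarrow> \<psi> (- x) * \<psi> x = 1" "x \<in> F \<Longrightarrow> \<psi> x * \<psi> (- x) = 1"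
  using psi_add[of "- x" x] by (simp_all add: mult.commute)

lemma psi_nonzero [simp]: "x \<in> F \<Longrightarrow> \<psi> x \<noteq> 0"
  using psi_uminus_mult(1)[of x] by (metis mult_zero_right zero_neq_one)

lemma sum_psi:
  assumes t: "t \<in> F"
  shows "(\<Sum>x\<in>F. \<psi> (t * x)) = (if t = 0 then of_nat (card F) else 0)"
proof (cases "t = 0")
  case False
  obtain u where u: "u \<in> F" "\<psi> u \<noteq> 1" using psi_nontrivial by auto
  define v where "v = finv t * u"
  have v: "v \<in> F" "t * v = u" using u t False by (auto simp: v_def)
  have "(\<Sum>x\<in>F. \<psi> (t * x)) = (\<Sum>x\<in>F. \<psi> (t * (x + v)))"
    using v by (simp add: sum_translate[of v "\<lambda>x. \<psi> (t * x)"])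
  also have "\<dots> = (\<Sum>x\<in>F. \<psi> (t * x) * \<psi> u)"
    using t u v by (intro sum.cong) (auto simp: distrib_left psi_add)
  also have "\<dots> = (\<Sum>x\<in>F. \<psi> (t * x)) * \<psi> u" by (simp add: sum_distrib_right)
  finally show ?thesis using u False by (auto simp: field_simps)
qed simp

text \<open>The quadratic Gauss sum.\<close>

definition gauss :: "'a \<Rightarrow> complex" where
  "gauss t = (\<Sum>x\<in>F. \<psi> (t * (x * x)))"

text \<open>The nonzero squares and the nonzero nonsquares together exhaust a sum that vanishes.\<close>

lemma gauss_nonsquare:
  assumes n: "n \<in> F" "n \<noteq> 0" "n \<notin> squares"
  shows "gauss n = - gauss e"
proof -
  have g: "gauss t = 1 + 2 * (\<Sum>s\<in>squares. \<psi> (t * s))" if "t \<in> F" for t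
  proof -
    have "gauss t = 1 + 2 * (\<Sum>x\<in>half. \<psi> (t * (x * x)))"
      unfolding gauss_def by (subst sum_even) auto
    then show ?thesis
      using sum.reindex[OF inj_on_square_half, of "\<lambda>s. \<psi> (t * s)"] by (simp add: square_half)
  qed
  have inj: "inj_on (\<lambda>s. n * s) squares"
    using mult_left_cancel[OF n(1,2)] squares_subset by (intro inj_onI) blast
  have "0 = (\<Sum>x\<in>F. \<psi> x)"
    using sum_psi[of e] by simp
  also have "\<dots> = 1 + (\<Sum>x\<in>F - {0}. \<psi> x)"
    by (subst sum.remove[of _ 0]) auto
  also have "(\<Sum>x\<in>F - {0}. \<psi> x) = (\<Sum>s\<in>squares. \<psi> s) + (\<Sum>s\<in>squares. \<psi> (n * s))"
    unfolding nonsquare_cover(1)[OF n] using nonsquare_cover(2)[OF n]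
    by (subst sum.union_disjoint) (auto simp: sum.reindex[OF inj])
  finally have z: "1 + ((\<Sum>s\<in>squares. \<psi> s) + (\<Sum>s\<in>squares. \<psi> (n * s))) = 0" by simp
  have "(\<Sum>s\<in>squares. \<psi> (e * s)) = (\<Sum>s\<in>squares. \<psi> s)"
    using squares_subset by (intro sum.cong) auto
  then have "gauss n + gauss e = 2 * (1 + ((\<Sum>s\<in>squares. \<psi> s) + (\<Sum>s\<in>squares. \<psi> (n * s))))"
    using g[of n] g[of e] n by (simp add: algebra_simps)
  then show ?thesis unfolding z by (simp add: eq_neg_iff_add_eq_0)
qed

lemma gauss_qchar:
  assumes t: "t \<in> F" "t \<noteq> 0"
  shows "gauss t = qchar t * gauss e"
proof (cases "t \<in> squares")
  case True
  then obtain a where a: "a \<in> F" "a \<noteq> 0" "t = a * a" by (auto simp: squares_def)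
  have "gauss t = (\<Sum>x\<in>F. \<psi> (e * ((a * x) * (a * x))))"
    unfolding gauss_def by (rule sum.cong) (use a in \<open>auto simp: mult_ac\<close>)
  also have "\<dots> = gauss e"
    unfolding gauss_def by (rule sum_scale[OF a(1,2)])
  finally show ?thesis using True by (simp add: qchar_def)
next
  case False
  then show ?thesis using gauss_nonsquare[of t] t by (simp add: qchar_def)
qed

lemma gauss_mult_gauss_uminus:
  "gauss e * gauss (- e) = of_nat (card F)"
proof -
  have "gauss e * gauss (- e) = (\<Sum>y\<in>F. \<Sum>x\<in>F. \<psi> (e * (x * x)) * \<psi> (- e * (y * y)))"
    unfolding gauss_def sum_product by (rule sum.swap)
  also have "\<dots> = (\<Sum>y\<in>F. \<Sum>x\<in>F. \<psi> (x * x - y * y))"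
    by (intro sum.cong) (auto simp flip: psi_add)
  \<comment> \<open>after the substitution \<open>x = z + y\<close> the exponent is linear in \<open>y\<close>\<close>
  also have "\<dots> = (\<Sum>y\<in>F. \<Sum>z\<in>F. \<psi> ((z + y) * (z + y) - y * y))"
    by (rule sum.cong[OF refl]) (rule sum_translate[symmetric])
  also have "\<dots> = (\<Sum>y\<in>F. \<Sum>z\<in>F. \<psi> (z * z) * \<psi> ((z + z) * y))"
    by (intro sum.cong) (auto simp: algebra_simps simp flip: psi_add)
  also have "\<dots> = (\<Sum>z\<in>F. \<psi> (z * z) * (\<Sum>y\<in>F. \<psi> ((z + z) * y)))"
    unfolding sum_distrib_left by (rule sum.swap)
  also have "\<dots> = (\<Sum>z\<in>F. if z = 0 then of_nat (card F) else 0)"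
    by (intro sum.cong) (auto simp: sum_psi)
  also have "\<dots> = of_nat (card F)" by (simp add: sum.delta)
  finally show ?thesis .
qed

lemma card_F_nonzero [simp]: "card F \<noteq> 0"
  using zero_mem finite_F by (metis card_0_eq empty_iff)

lemma gauss_e_nonzero [simp]: "gauss e \<noteq> 0"
  using gauss_mult_gauss_uminus by auto

lemma gauss_e_square: "gauss e * gauss e = qchar (- e) * of_nat (card F)"
proof -
  have "gauss (- e) = qchar (- e) * gauss e" by (rule gauss_qchar) simp_all
  then have "qchar (- e) * (gauss e * gauss (- e)) = (qchar (- e) * qchar (- e)) * (gauss e * gauss e)"
    by (simp only: mult_ac)
  then show ?thesis unfolding gauss_mult_gauss_uminus by simp
qed

text \<open>Completing the square, with centre \<open>s / t\<close>.\<close>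

lemma sum_psi_quadratic:
  assumes "t \<in> F" "t \<noteq> 0" "s \<in> F"
  shows "(\<Sum>y\<in>F. \<psi> (t * (y * y) - (s * y + s * y))) = \<psi> (- (s * s * finv t)) * (qchar t * gauss e)"
proof -
  define v where "v = finv t * s"
  have v: "v \<in> F" "t * v = s" using assms by (auto simp: v_def)
  have "(\<Sum>y\<in>F. \<psi> (t * (y * y) - (s * y + s * y))) =
    (\<Sum>y\<in>F. \<psi> (t * ((y + v) * (y + v)) - (s * (y + v) + s * (y + v))))"
    using v(1) by (rule sum_translate[symmetric])
  also have "\<dots> = (\<Sum>y\<in>F. \<psi> (- (s * s * finv t)) * \<psi> (t * (y * y)))"
  proof (rule sum.cong)
    fix y assume y: "y \<in> F"
    have sv: "s * v = s * s * finv t" by (simp add: v_def mult_ac)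
    have "t * ((y + v) * (y + v)) = t * (y * y) + (t * v) * y + (t * v) * y + (t * v) * v"
      by (simp add: algebra_simps)
    also have "\<dots> - (s * (y + v) + s * (y + v)) = - (s * v) + t * (y * y)"
      unfolding v(2) by (simp add: algebra_simps)
    finally show "\<psi> (t * ((y + v) * (y + v)) - (s * (y + v) + s * (y + v))) =
      \<psi> (- (s * s * finv t)) * \<psi> (t * (y * y))"
      using psi_add[of "- (s * s * finv t)" "t * (y * y)"] assms y by (simp only: sv) simp
  qed simp
  also have "\<dots> = \<psi> (- (s * s * finv t)) * gauss t"
    by (simp add: gauss_def sum_distrib_left)
  finally show ?thesis by (simp only: gauss_qchar[OF assms(1,2)])
qed

end

text \<open>The \<open>n\<close>-fold sum of \<open>x\<close>.\<close>

primrec multiple :: "nat \<Rightarrow> 'a::comm_monoid_add \<Rightarrow> 'a" where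
  "multiple 0 x = 0"
| "multiple (Suc n) x = x + multiple n x"

lemma multiple_add: "multiple (m + n) x = multiple m x + multiple n x"
  by (induction m) (simp_all add: add_ac)

text \<open>
  Take a maximal proper additive subgroup \<open>H\<close> and \<open>x \<notin> H\<close>. Then \<open>F\<close> is the sum of \<open>H\<close> and the multiples of
  \<open>x\<close>, and if \<open>m\<close> is the order of \<open>x\<close> modulo \<open>H\<close>, a nontrivial character sends \<open>h + j x\<close> to \<open>\<omega>\<^sup>j\<close> for an
  \<open>m\<close>-th root of unity \<open>\<omega> \<noteq> 1\<close>.
\<close>

lemma (in odd_finite_field) exists_additive_character:
  "\<exists>\<psi>. additive_character F e \<psi>"
proof -
  define sub where "sub H \<longleftrightarrow> H \<subseteq> F \<and> 0 \<in> H \<and> (\<forall>x\<in>H. - x \<in> H) \<and> (\<forall>x\<in>H. \<forall>y\<in>H. x + y \<in> H)" for H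
  define \<H> where "\<H> = {H. sub H \<and> H \<noteq> F}"
  have fin: "finite \<H>" by (rule finite_subset[of _ "Pow F"]) (auto simp: \<H>_def sub_def)
  have "F \<noteq> {0}" using e_mem e_nonzero by blast
  then have "{0} \<in> \<H>" by (auto simp: \<H>_def sub_def)
  then obtain H where H: "H \<in> \<H>" and max: "\<And>H'. H' \<in> \<H> \<Longrightarrow> H \<subseteq> H' \<Longrightarrow> H' = H"
    using finite_has_maximal[OF fin] by blast
  have sH: "sub H" and HF: "H \<noteq> F" using H by (auto simp: \<H>_def)
  then obtain x where x: "x \<in> F" "x \<notin> H" by (auto simp: sub_def)
  have H0: "0 \<in> H" and Hm: "\<And>y. y \<in> H \<Longrightarrow> - y \<in> H"
    and Ha: "\<And>y z. y \<in> H \<Longrightarrow> z \<in> H \<Longrightarrow> y + z \<in> H" and HsF: "H \<subseteq> F"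
    using sH by (auto simp: sub_def)
  have mF: "multiple n x \<in> F" for n by (induction n) (use x in auto)
  have "\<not> inj (\<lambda>n. multiple n x)"
    using mF finite_subset[of "range (\<lambda>n. multiple n x)" F] finite_F
    by (metis finite_imageD image_subsetI infinite_UNIV_nat)
  then obtain i j where ij: "i < j" "multiple i x = multiple j x"
    unfolding inj_def by (metis linorder_neqE_nat)
  have n0: "multiple (j - i) x = 0"
    using multiple_add[of i "j - i" x] ij by simp
  define n where "n = j - i"
  have n: "n > 0" "multiple n x = 0" using ij n0 by (auto simp: n_def)
  have nk: "multiple (n * k) x = 0" for k by (induction k) (simp_all add: multiple_add n)
  define H' where "H' = {h + multiple j x | h j. h \<in> H}"
  have "sub H'"
    unfolding sub_def
  proof (intro conjI ballI)
    show "H' \<subseteq> F" using HsF mF by (auto simp: H'_def)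
    show "0 \<in> H'" unfolding H'_def using H0 by (auto intro!: exI[of _ 0] exI[of _ "0::nat"])
    show "- y \<in> H'" if y: "y \<in> H'" for y
    proof -
      obtain h j where hj: "h \<in> H" "y = h + multiple j x" using y by (auto simp: H'_def)
      have "multiple (n * j - j) x + multiple j x = 0"
        using multiple_add[of "n * j - j" j x] n by (simp add: nk)
      then have "multiple (n * j - j) x = - multiple j x" by (simp add: eq_neg_iff_add_eq_0)
      then have "- y = - h + multiple (n * j - j) x" using hj by simp
      then show ?thesis unfolding H'_def using Hm[OF hj(1)] by blast
    qed
    show "y + z \<in> H'" if yz: "y \<in> H'" "z \<in> H'" for y z
    proof -
      obtain h j where hj: "h \<in> H" "y = h + multiple j x" using yz by (auto simp: H'_def)
      obtain h' j' where hj': "h' \<in> H" "z = h' + multiple j' x" using yz by (auto simp: H'_def)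
      have "y + z = (h + h') + multiple (j + j') x"
        using hj hj' by (simp add: multiple_add add_ac)
      then show ?thesis unfolding H'_def using Ha[OF hj(1) hj'(1)] by blast
    qed
  qed
  moreover have "H \<subseteq> H'"
  proof
    fix y assume "y \<in> H"
    then show "y \<in> H'" unfolding H'_def by (auto intro!: exI[of _ y] exI[of _ "0::nat"])
  qed
  moreover have "x \<in> H'"
    unfolding H'_def using H0 by (auto intro!: exI[of _ 0] exI[of _ "1::nat"])
  ultimately have H'F: "H' = F" using max[of H'] x by (auto simp: \<H>_def)
  define m where "m = (LEAST m. m > 0 \<and> multiple m x \<in> H)"
  have m: "m > 0" "multiple m x \<in> H"
    using LeastI[of "\<lambda>m. m > 0 \<and> multiple m x \<in> H" n] n H0 by (auto simp: m_def)
  have mk: "multiple (m * k) x \<in> H" for k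
    by (induction k) (simp_all add: multiple_add H0 Ha m)
  have dvd: "m dvd j" if j: "multiple j x \<in> H" for j
  proof -
    have "multiple j x = multiple (m * (j div m)) x + multiple (j mod m) x"
      by (simp flip: multiple_add)
    then have "multiple (j mod m) x = multiple j x + - multiple (m * (j div m)) x"
      by simp
    then have "multiple (j mod m) x \<in> H" using j mk Ha Hm by metis
    moreover have "\<not> (j mod m > 0 \<and> multiple (j mod m) x \<in> H)"
      using not_less_Least[of "j mod m" "\<lambda>m. m > 0 \<and> multiple m x \<in> H"] m(1) by (simp add: m_def)
    ultimately show ?thesis by (simp add: dvd_eq_mod_eq_0)
  qed
  have "m \<noteq> 1" using m(2) x by auto
  then have "m \<ge> 2" using m(1) by simp
  then have "{z::complex. z ^ m = 1} \<noteq> {1}"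
    using card_roots_unity_eq[of m] by auto
  moreover have "1 \<in> {z::complex. z ^ m = 1}" by simp
  ultimately obtain \<omega> :: complex where \<omega>: "\<omega> ^ m = 1" "\<omega> \<noteq> 1" by blast
  define \<psi> where "\<psi> y = \<omega> ^ (SOME j. \<exists>h\<in>H. y = h + multiple j x)" for y
  have le: "\<omega> ^ j = \<omega> ^ j'" if "h \<in> H" "h' \<in> H" "h + multiple j x = h' + multiple j' x" "j \<le> j'" for h h' j j'
  proof -
    obtain d where d: "j' = j + d" using \<open>j \<le> j'\<close> le_Suc_ex by blast
    have "multiple d x = h + - h'"
      using that(3) by (simp add: d multiple_add algebra_simps)
    then have "multiple d x \<in> H" using that Ha Hm by metis
    then obtain k where "d = m * k" using dvd by (auto elim: dvdE)
    then show ?thesis using \<omega> by (simp add: d power_add power_mult)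
  qed
  have \<psi>: "\<psi> (h + multiple j x) = \<omega> ^ j" if h: "h \<in> H" for h j
  proof -
    define j' where "j' = (SOME j'. \<exists>h'\<in>H. h + multiple j x = h' + multiple j' x)"
    have "\<exists>h'\<in>H. h + multiple j x = h' + multiple j' x"
      unfolding j'_def by (rule someI_ex) (use h in blast)
    then obtain h' where h': "h' \<in> H" "h + multiple j x = h' + multiple j' x" by blast
    have "\<omega> ^ j = \<omega> ^ j'"
      using le[OF h h'(1,2)] le[OF h'(1) h h'(2)[symmetric]] by (metis nle_le)
    then show ?thesis by (simp add: \<psi>_def j'_def)
  qed
  have "additive_character F e \<psi>"
  proof
    show "\<psi> 0 = 1" using \<psi>[OF H0, of 0] by simp
    show "\<exists>u\<in>F. \<psi> u \<noteq> 1" using \<psi>[OF H0, of 1] x \<omega> by (intro bexI[of _ x]) auto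
    show "\<psi> (y + z) = \<psi> y * \<psi> z" if yz: "y \<in> F" "z \<in> F" for y z
    proof -
      obtain h j where hj: "h \<in> H" "y = h + multiple j x" using yz(1) H'F unfolding H'_def by blast
      obtain h' j' where hj': "h' \<in> H" "z = h' + multiple j' x" using yz(2) H'F unfolding H'_def by blast
      have "y + z = (h + h') + multiple (j + j') x"
        using hj hj' by (simp add: multiple_add add_ac)
      moreover have "\<psi> y = \<omega> ^ j" "\<psi> z = \<omega> ^ j'" using \<psi> hj hj' by auto
      ultimately show ?thesis using \<psi>[OF Ha[OF hj(1) hj'(1)], of "j + j'"] by (simp add: power_add)
    qed
  qed
  then show ?thesis by (intro exI[of _ \<psi>])
qed

lemma (in additive_character) scale_character:
  assumes c: "c \<in> F" "c \<noteq> 0"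
  shows "additive_character F e (\<lambda>x. \<psi> (c * x))"
proof
  obtain u where u: "u \<in> F" "\<psi> u \<noteq> 1" using psi_nontrivial by blast
  show "\<exists>u\<in>F. \<psi> (c * u) \<noteq> 1" using u c by (intro bexI[of _ "finv c * u"]) auto
qed (use c in \<open>auto simp: distrib_left psi_add\<close>)

section \<open>The Weil representation on kernels\<close>

context odd_finite_field
begin

text \<open>
  The group \<open>SL\<^sub>2(F)\<close>; the quadruple \<open>(a, b, c, d)\<close> stands for the matrix with rows \<open>(a, b)\<close> and \<open>(c, d)\<close>.
\<close>

definition sl2 :: "('a \<times> 'a \<times> 'a \<times> 'a) monoid" where
  "sl2 = \<lparr>carrier = {(a, b, c, d). a \<in> F \<and> b \<in> F \<and> c \<in> F \<and> d \<in> F \<and> a * d - b * c = e},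
    monoid.mult = (\<lambda>(a, b, c, d) (a', b', c', d').
      (a * a' + b * c', a * b' + b * d', c * a' + d * c', c * b' + d * d')),
    one = (e, 0, 0, e)\<rparr>"

lemma carrier_sl2 [simp]: "(a, b, c, d) \<in> carrier sl2 \<longleftrightarrow>
    a \<in> F \<and> b \<in> F \<and> c \<in> F \<and> d \<in> F \<and> a * d - b * c = e"
  by (simp add: sl2_def)

lemma mult_sl2 [simp]: "(a, b, c, d) \<otimes>\<^bsub>sl2\<^esub> (a', b', c', d') =
    (a * a' + b * c', a * b' + b * d', c * a' + d * c', c * b' + d * d')"
  by (simp add: sl2_def)

lemma one_sl2 [simp]: "\<one>\<^bsub>sl2\<^esub> = (e, 0, 0, e)"
  by (simp add: sl2_def)

lemma finite_sl2 [simp]: "finite (carrier sl2)"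
  by (rule finite_subset[of _ "F \<times> F \<times> F \<times> F"]) (auto simp: sl2_def)

lemma group_sl2: "group sl2"
proof (rule groupI)
  fix x y z assume x: "x \<in> carrier sl2" and y: "y \<in> carrier sl2" and z: "z \<in> carrier sl2"
  obtain a b c d where X: "x = (a, b, c, d)" by (metis prod_cases4)
  obtain a' b' c' d' where Y: "y = (a', b', c', d')" by (metis prod_cases4)
  obtain a'' b'' c'' d'' where Z: "z = (a'', b'', c'', d'')" by (metis prod_cases4)
  have "(a * a' + b * c') * (c * b' + d * d') - (a * b' + b * d') * (c * a' + d * c') =
      (a * d - b * c) * (a' * d' - b' * c')"
    by (simp add: algebra_simps)
  also have "\<dots> = e" using x y X Y by simp
  finally show "x \<otimes>\<^bsub>sl2\<^esub> y \<in> carrier sl2" using x y X Y by simp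
  show "x \<otimes>\<^bsub>sl2\<^esub> y \<otimes>\<^bsub>sl2\<^esub> z = x \<otimes>\<^bsub>sl2\<^esub> (y \<otimes>\<^bsub>sl2\<^esub> z)"
    by (simp add: X Y Z algebra_simps)
  show "\<one>\<^bsub>sl2\<^esub> \<otimes>\<^bsub>sl2\<^esub> x = x" using x by (simp add: X)
  show "\<exists>y\<in>carrier sl2. y \<otimes>\<^bsub>sl2\<^esub> x = \<one>\<^bsub>sl2\<^esub>"
    using x by (intro bexI[of _ "(d, - b, - c, a)"]) (auto simp: X algebra_simps)
qed simp

end

context additive_character
begin

text \<open>
  The kernel of the Weil representation: the matrix \<open>g\<close> sends a function \<open>f\<close> on \<open>F\<close> to the function whose
  value at \<open>x\<close> is the sum of \<open>weil g x y * f y\<close> over \<open>y\<close>. The character \<open>\<psi>\<close> is normalized such that no factor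
  \<open>1 / 2\<close> occurs in the exponents. The constants \<open>qchar a\<close> and \<open>qchar c / gauss e\<close> are what turns the
  projective action of the group into a linear one.
\<close>

definition weil :: "'a \<times> 'a \<times> 'a \<times> 'a \<Rightarrow> 'a \<Rightarrow> 'a \<Rightarrow> complex" where
  "weil = (\<lambda>(a, b, c, d) x y.
     if c = 0 then (if y = a * x then qchar a * \<psi> (a * b * (x * x)) else 0)
     else qchar c / gauss e * \<psi> (finv c * (a * (x * x) - (x * y + x * y) + d * (y * y))))"

lemma weil_uminus: "x \<in> F \<Longrightarrow> y \<in> F \<Longrightarrow> weil g (- x) (- y) = weil g x y"
  by (cases g) (simp add: weil_def)

lemma sum_weil_upper_left:
  assumes "a \<in> F" "x \<in> F"
  shows "(\<Sum>y\<in>F. weil (a, b, 0, d) x y * f y) = qchar a * \<psi> (a * b * (x * x)) * f (a * x)"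
proof -
  have "(\<Sum>y\<in>F. weil (a, b, 0, d) x y * f y) =
      (\<Sum>y\<in>F. if y = a * x then qchar a * \<psi> (a * b * (x * x)) * f (a * x) else 0)"
    by (intro sum.cong) (auto simp: weil_def)
  then show ?thesis using assms by (simp add: sum.delta)
qed

lemma sum_weil_upper_right:
  assumes "a \<in> F" "d \<in> F" "a * d = e" "z \<in> F"
  shows "(\<Sum>y\<in>F. f y * weil (a, b, 0, d) y z) =
    f (d * z) * (qchar a * \<psi> (a * b * ((d * z) * (d * z))))"
proof -
  have iff: "z = a * y \<longleftrightarrow> y = d * z" if "y \<in> F" for y
  proof
    assume "z = a * y"
    then have "d * z = (a * d) * y" by (simp add: mult_ac)
    then show "y = d * z" using assms that by simp
  next
    assume "y = d * z"
    then have "a * y = (a * d) * z" by (simp add: mult_ac)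
    then show "z = a * y" using assms by simp
  qed
  have "(\<Sum>y\<in>F. f y * weil (a, b, 0, d) y z) =
      (\<Sum>y\<in>F. if y = d * z then f (d * z) * (qchar a * \<psi> (a * b * ((d * z) * (d * z)))) else 0)"
    by (intro sum.cong) (auto simp: weil_def iff)
  then show ?thesis using assms by (simp add: sum.delta)
qed

text \<open>
  Multiplicativity of the kernel, case by case: a matrix is upper triangular, with \<open>c = 0\<close>, or lies in the
  big cell, where \<open>c \<noteq> 0\<close>.
\<close>

lemma weil_mult_upper_upper:
  assumes g: "(a, b, 0, d) \<in> carrier sl2" and h: "(a', b', 0, d') \<in> carrier sl2"
    and x: "x \<in> F" and z: "z \<in> F"
  shows "(\<Sum>y\<in>F. weil (a, b, 0, d) x y * weil (a', b', 0, d') y z) =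
    weil (a * a', a * b' + b * d', 0, d * d') x z"
proof -
  have F: "a \<in> F" "b \<in> F" "a' \<in> F" "b' \<in> F" "d' \<in> F" and ad': "a' * d' = e" and ad: "a * d = e"
    using g h by auto
  have nz: "a \<noteq> 0" "a' \<noteq> 0" using ad ad' by auto
  have "a * a' * (a * b' + b * d') * (x * x) =
      a' * b' * ((a * x) * (a * x)) + (a' * d') * (a * b * (x * x))"
    by (simp add: algebra_simps)
  also have "\<dots> = a * b * (x * x) + a' * b' * ((a * x) * (a * x))"
    using F x by (simp add: ad' add.commute)
  finally have "\<psi> (a * a' * (a * b' + b * d') * (x * x)) =
      \<psi> (a * b * (x * x)) * \<psi> (a' * b' * ((a * x) * (a * x)))"
    using F x by (simp add: psi_add)
  then show ?thesis
    using F x nz by (subst sum_weil_upper_left) (auto simp: weil_def qchar_mult mult_ac)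
qed

lemma weil_mult_upper_big:
  assumes g: "(a, b, 0, d) \<in> carrier sl2" and h: "(a', b', c', d') \<in> carrier sl2" and c': "c' \<noteq> 0"
    and x: "x \<in> F" and z: "z \<in> F"
  shows "(\<Sum>y\<in>F. weil (a, b, 0, d) x y * weil (a', b', c', d') y z) =
    weil (a * a' + b * c', a * b' + b * d', d * c', d * d') x z"
proof -
  have F: "a \<in> F" "b \<in> F" "d \<in> F" "a' \<in> F" "b' \<in> F" "c' \<in> F" "d' \<in> F" and ad: "a * d = e"
    using g h by auto
  have nz: "a \<noteq> 0" "d \<noteq> 0" using ad by auto
  define k where "k = finv c'"
  have k: "k \<in> F" "k \<noteq> 0" "c' * k = e" using F c' by (auto simp: k_def)
  have "(d * c') * (a * k) = (a * d) * (c' * k)" by (simp only: mult_ac)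
  then have fk: "finv (d * c') = a * k"
    using F k by (intro finv_unique) (auto simp: ad k)
  have "a * k * ((a * a' + b * c') * (x * x) - (x * z + x * z) + d * d' * (z * z)) =
      (c' * k) * (a * b * (x * x)) + k * (a' * ((a * x) * (a * x)) - (a * x * z + a * x * z)
        + (a * d) * (d' * (z * z)))"
    by (simp add: algebra_simps)
  also have "\<dots> = a * b * (x * x) + k * (a' * ((a * x) * (a * x)) - (a * x * z + a * x * z) + d' * (z * z))"
    using F x z by (simp add: k ad)
  finally have "\<psi> (a * k * ((a * a' + b * c') * (x * x) - (x * z + x * z) + d * d' * (z * z))) =
      \<psi> (a * b * (x * x)) * \<psi> (k * (a' * ((a * x) * (a * x)) - (a * x * z + a * x * z) + d' * (z * z)))"
    using F x z k by (simp add: psi_add)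
  moreover have "qchar d = qchar a" using F ad by (intro qchar_inverse) (auto simp: mult.commute)
  ultimately show ?thesis
    using F x nz c' fk by (subst sum_weil_upper_left) (auto simp: weil_def qchar_mult k_def)
qed

lemma weil_mult_big_upper:
  assumes g: "(a, b, c, d) \<in> carrier sl2" and h: "(a', b', 0, d') \<in> carrier sl2" and c: "c \<noteq> 0"
    and x: "x \<in> F" and z: "z \<in> F"
  shows "(\<Sum>y\<in>F. weil (a, b, c, d) x y * weil (a', b', 0, d') y z) =
    weil (a * a', a * b' + b * d', c * a', c * b' + d * d') x z"
proof -
  have F: "a \<in> F" "b \<in> F" "c \<in> F" "d \<in> F" "a' \<in> F" "b' \<in> F" "d' \<in> F" and ad: "a' * d' = e"
    using g h by auto
  have nz: "a' \<noteq> 0" "d' \<noteq> 0" using ad by auto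
  define k where "k = finv c"
  have k: "k \<in> F" "k \<noteq> 0" "c * k = e" using F c by (auto simp: k_def)
  have "(c * a') * (k * d') = (a' * d') * (c * k)" by (simp only: mult_ac)
  then have fk: "finv (c * a') = k * d'"
    using F k by (intro finv_unique) (auto simp: ad k)
  have "k * d' * (a * a' * (x * x) - (x * z + x * z) + (c * b' + d * d') * (z * z)) =
      k * ((a' * d') * (a * (x * x)) - (x * (d' * z) + x * (d' * z)) + d * ((d' * z) * (d' * z)))
       + (c * k) * (b' * d' * (z * z))"
    by (simp add: algebra_simps)
  also have "\<dots> = k * (a * (x * x) - (x * (d' * z) + x * (d' * z)) + d * ((d' * z) * (d' * z)))
       + (a' * d') * (b' * d' * (z * z))"
    using F x z by (simp add: k ad)
  also have "(a' * d') * (b' * d' * (z * z)) = a' * b' * ((d' * z) * (d' * z))"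
    by (simp only: mult_ac)
  finally have "\<psi> (k * d' * (a * a' * (x * x) - (x * z + x * z) + (c * b' + d * d') * (z * z))) =
      \<psi> (k * (a * (x * x) - (x * (d' * z) + x * (d' * z)) + d * ((d' * z) * (d' * z))))
       * \<psi> (a' * b' * ((d' * z) * (d' * z)))"
    using F x z k by (simp add: psi_add)
  then show ?thesis
    using F x z nz c fk ad by (subst sum_weil_upper_right) (auto simp: weil_def qchar_mult k_def)
qed

lemma weil_mult_big_big:
  assumes g: "(a, b, c, d) \<in> carrier sl2" and h: "(a', b', c', d') \<in> carrier sl2"
    and c: "c \<noteq> 0" and c': "c' \<noteq> 0" and x: "x \<in> F" and z: "z \<in> F"
  shows "(\<Sum>y\<in>F. weil (a, b, c, d) x y * weil (a', b', c', d') y z) =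
    weil (a * a' + b * c', a * b' + b * d', c * a' + d * c', c * b' + d * d') x z"
proof -
  have F: "a \<in> F" "b \<in> F" "c \<in> F" "d \<in> F" "a' \<in> F" "b' \<in> F" "c' \<in> F" "d' \<in> F"
    and ad: "a * d = b * c + e" and ad': "a' * d' = b' * c' + e"
    using g h by (auto simp: algebra_simps)
  define k k' where kk: "k = finv c" "k' = finv c'"
  have k: "k \<in> F" "k \<noteq> 0" "c * k = e" using F c by (auto simp: kk)
  have k': "k' \<in> F" "k' \<noteq> 0" "c' * k' = e" using F c' by (auto simp: kk)
  \<comment> \<open>the exponent of the product is \<open>A + t y\<^sup>2 - 2 s y\<close>, and \<open>t = c'' / (c c')\<close>\<close>
  define t s A where t: "t = k * d + k' * a'" and s: "s = k * x + k' * z"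
    and A: "A = k * a * (x * x) + k' * d' * (z * z)"
  have tF: "t \<in> F" and sF: "s \<in> F" and AF: "A \<in> F" using F k k' x z by (auto simp: t s A)
  define a'' b'' c'' d'' where g'': "a'' = a * a' + b * c'" "b'' = a * b' + b * d'"
    "c'' = c * a' + d * c'" "d'' = c * b' + d * d'"
  have F'': "a'' \<in> F" "b'' \<in> F" "c'' \<in> F" "d'' \<in> F" using F by (auto simp: g'')
  have prod: "weil (a, b, c, d) x y * weil (a', b', c', d') y z =
      qchar c * qchar c' / (gauss e * gauss e) * \<psi> A * \<psi> (t * (y * y) - (s * y + s * y))"
    if y: "y \<in> F" for y
  proof -
    have "k * (a * (x * x) - (x * y + x * y) + d * (y * y)) +
        k' * (a' * (y * y) - (y * z + y * z) + d' * (z * z)) = A + (t * (y * y) - (s * y + s * y))"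
      by (simp add: A t s algebra_simps)
    then have "\<psi> (k * (a * (x * x) - (x * y + x * y) + d * (y * y))) *
        \<psi> (k' * (a' * (y * y) - (y * z + y * z) + d' * (z * z))) =
        \<psi> A * \<psi> (t * (y * y) - (s * y + s * y))"
      using F k k' x y z AF tF sF by (simp flip: psi_add)
    then show ?thesis using c c' by (simp add: weil_def flip: kk)
  qed
  have sum: "(\<Sum>y\<in>F. weil (a, b, c, d) x y * weil (a', b', c', d') y z) =
      qchar c * qchar c' / (gauss e * gauss e) * \<psi> A * (\<Sum>y\<in>F. \<psi> (t * (y * y) - (s * y + s * y)))"
    unfolding sum_distrib_left by (rule sum.cong) (simp_all add: prod)
  have "c'' * (k * k') = (c * k) * (k' * a') + (c' * k') * (k * d)"
    by (simp add: g'' algebra_simps)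
  then have tc: "t = c'' * (k * k')" using F k k' by (simp add: t add.commute)
  show ?thesis
  proof (cases "c'' = 0")
    case False
    define k'' where k'': "k'' = finv c''"
    have kF: "k'' \<in> F" "k'' \<noteq> 0" "c'' * k'' = e" using False F'' by (auto simp: k'')
    have t0: "t \<noteq> 0" using False F'' k k' by (simp add: tc)
    have "t * (c * c' * k'') = (c'' * k'') * ((c * k) * (c' * k'))"
      by (simp add: tc mult_ac)
    then have ft: "finv t = c * c' * k''" using F kF tF k k' by (intro finv_unique) auto
    have "c'' * (k * a) = (c * k) * (a * a') + k * c' * (a * d)"
      by (simp add: g'' algebra_simps)
    also have "\<dots> = (c * k) * (a * a') + (c * k) * (b * c') + k * (c' * e)"
      unfolding ad by (simp add: algebra_simps)
    also have "\<dots> = a'' + k * c'" using F k by (simp add: g'')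
    finally have 1: "k * a = k'' * (a'' + k * c')"
      using finv_mult_left[of c'' "k * a"] False F'' F k by (simp add: k'')
    have "c'' * (k' * d') = (c' * k') * (d * d') + k' * c * (a' * d')"
      by (simp add: g'' algebra_simps)
    also have "\<dots> = (c' * k') * (d * d') + (c' * k') * (c * b') + k' * (c * e)"
      unfolding ad' by (simp add: algebra_simps)
    also have "\<dots> = d'' + k' * c" using F k' by (simp add: g'')
    finally have 2: "k' * d' = k'' * (d'' + k' * c)"
      using finv_mult_left[of c'' "k' * d'"] False F'' F k' by (simp add: k'')
    have "s * s * (c * c' * k'') = k'' * ((c * k) * (k * c' * (x * x)) +
        (c * k) * ((c' * k') * (x * z)) + (c * k) * ((c' * k') * (x * z)) + (c' * k') * (k' * c * (z * z)))"
      by (simp add: s algebra_simps)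
    also have "\<dots> = k'' * (k * c' * (x * x) + (x * z + x * z) + k' * c * (z * z))"
      using F k k' x z by (simp add: add.assoc)
    finally have 3: "s * s * (c * c' * k'') =
      k'' * (k * c' * (x * x) + (x * z + x * z) + k' * c * (z * z))" .
    have "A + - (s * s * finv t) = k'' * (a'' * (x * x) - (x * z + x * z) + d'' * (z * z))"
      unfolding A ft 1 2 3 by (simp add: algebra_simps)
    then have \<psi>: "\<psi> A * \<psi> (- (s * s * finv t)) =
        \<psi> (k'' * (a'' * (x * x) - (x * z + x * z) + d'' * (z * z)))"
      using AF sF tF t0 by (simp flip: psi_add)
    have "qchar t = qchar c'' * (qchar c * qchar c')"
      unfolding tc using False F'' F k k' c c' by (simp add: qchar_mult kk)
    then have "qchar c * qchar c' * qchar t = (qchar c * qchar c) * (qchar c' * qchar c') * qchar c''"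
      by (simp only: mult_ac)
    then have q: "qchar c * qchar c' * qchar t = qchar c''" by simp
    have "(\<Sum>y\<in>F. weil (a, b, c, d) x y * weil (a', b', c', d') y z) =
      (qchar c * qchar c' * qchar t) / gauss e * (\<psi> A * \<psi> (- (s * s * finv t)))"
      unfolding sum sum_psi_quadratic[OF tF t0 sF] by (simp add: field_simps)
    then show ?thesis
      unfolding q \<psi> using False by (simp add: weil_def k'' flip: g'')
  next
    case True
    \<comment> \<open>the exponent is now linear in \<open>y\<close>, so the sum over \<open>y\<close> is supported on \<open>s = 0\<close>\<close>
    have t0: "t = 0" by (simp add: tc True)
    have "c * a'' = (a * d) * c' + c * (a * a') - c' * e"
      unfolding ad by (simp add: g'' algebra_simps)
    also have "\<dots> = a * c'' - c'" using F by (simp add: g'' algebra_simps)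
    finally have ca: "c * a'' = - c'" by (simp add: True)
    have a'': "a'' = - (k * c')"
      using finv_mult_left[of c a''] F F'' c ca by (simp add: kk)
    have "c' * s = z + (- a'') * x"
      using F k' z x by (simp add: s a'' distrib_left mult_ac)
        (metis k'(3) e_mult mult.assoc add.commute z)
    then have cs: "c' * s = z - a'' * x" by simp
    have s0: "s = 0 \<longleftrightarrow> z = a'' * x"
      using mult_eq_zero[of c' s] F sF c' unfolding cs by auto
    have "(\<Sum>y\<in>F. \<psi> (t * (y * y) - (s * y + s * y))) = (\<Sum>y\<in>F. \<psi> (- (s + s) * y))"
      by (rule sum.cong) (auto simp: t0 algebra_simps)
    also have "\<dots> = (if s = 0 then of_nat (card F) else 0)"
      using sF by (subst sum_psi) auto
    finally have S: "(\<Sum>y\<in>F. weil (a, b, c, d) x y * weil (a', b', c', d') y z) =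
      (if s = 0 then qchar c * qchar c' / (gauss e * gauss e) * \<psi> A * of_nat (card F) else 0)"
      unfolding sum by simp
    have W: "weil (a'', b'', c'', d'') x z =
      (if z = a'' * x then qchar a'' * \<psi> (a'' * b'' * (x * x)) else 0)"
      by (simp add: weil_def True)
    have A': "A = a'' * b'' * (x * x)" if z: "z = a'' * x"
    proof -
      have "A = (k * a + (k' * a'') * (d' * a'')) * (x * x)"
        by (simp add: A z algebra_simps)
      also have "k' * a'' = - ((c' * k') * k)" by (simp add: a'' mult_ac)
      also have "\<dots> = - k" using k k' by simp
      finally have "A = k * (a - d' * a'') * (x * x)" by (simp add: algebra_simps)
      moreover have "a * (a' * d') - (a * (b' * c') + a * e) = 0" unfolding ad' by (simp add: algebra_simps)
      then have "a - d' * a'' = - (c' * b'')" using F by (simp add: g'' algebra_simps)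
      ultimately show ?thesis by (simp add: a'' mult_ac)
    qed
    have "qchar a'' = qchar ((- e) * (k * c'))" using F k by (simp add: a'')
    also have "\<dots> = qchar (- e) * (qchar c * qchar c')"
      using F k c c' by (simp add: qchar_mult kk del: minus_mult_left minus_mult_right mult_minus_left)
    finally have "qchar c * qchar c' / (gauss e * gauss e) * of_nat (card F) = qchar a''"
      unfolding gauss_e_square by (simp add: field_simps)
    then show ?thesis
      unfolding S W[unfolded g''] s0 using A' by (auto simp: field_simps g'')
  qed
qed

theorem weil_mult:
  assumes "g \<in> carrier sl2" "h \<in> carrier sl2" "x \<in> F" "z \<in> F"
  shows "(\<Sum>y\<in>F. weil g x y * weil h y z) = weil (g \<otimes>\<^bsub>sl2\<^esub> h) x z"
proof -
  obtain a b c d where g: "g = (a, b, c, d)" by (metis prod_cases4)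
  obtain a' b' c' d' where h: "h = (a', b', c', d')" by (metis prod_cases4)
  show ?thesis
    using assms weil_mult_upper_upper weil_mult_upper_big weil_mult_big_upper weil_mult_big_big
    unfolding g h by (cases "c = 0"; cases "c' = 0") auto
qed

end

section \<open>The even and the odd part\<close>

lemma subspaceD:
  assumes "is_subspace n W"
  shows "W \<subseteq> carrier_vec n" "0\<^sub>v n \<in> W" "v \<in> W \<Longrightarrow> w \<in> W \<Longrightarrow> v + w \<in> W" "v \<in> W \<Longrightarrow> c \<cdot>\<^sub>v v \<in> W"
  using assms
  by (auto simp: VectorSpace.subspace_def LinearCombinations.submodule_def module_vec_def)

lemma subspace_sum:
  assumes W: "is_subspace n W" and B: "finite B" and f: "\<And>b. b \<in> B \<Longrightarrow> f b \<in> W"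
  shows "vec n (\<lambda>k. \<Sum>b\<in>B. f b $ k) \<in> W"
  using B f
proof (induction B)
  case empty
  have "vec n (\<lambda>k. \<Sum>b\<in>{}. f b $ k) = 0\<^sub>v n" by auto
  then show ?case using subspaceD(2)[OF W] by simp
next
  case (insert b B)
  have c: "f b \<in> carrier_vec n" using insert.prems subspaceD(1)[OF W] by auto
  have "vec n (\<lambda>k. \<Sum>b\<in>insert b B. f b $ k) = f b + vec n (\<lambda>k. \<Sum>b\<in>B. f b $ k)"
    using insert.hyps c by auto
  then show ?case using insert subspaceD(3)[OF W] by simp
qed

context odd_finite_field
begin

text \<open>
  The index set of a basis of the even functions (for \<open>\<sigma> = 1\<close>) or the odd functions (for \<open>\<sigma> = - 1\<close>): the
  basis element with index \<open>y\<close> is \<open>\<delta>\<^sub>y + \<sigma> \<delta>\<^sub>-\<^sub>y\<close> for \<open>y \<noteq> 0\<close>, and \<open>\<delta>\<^sub>0\<close> for \<open>y = 0\<close>, which occurs only in the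
  even case.
\<close>

definition parity_index :: "complex \<Rightarrow> 'a set" where
  "parity_index \<sigma> = (if \<sigma> = 1 then insert 0 half else half)"

end

text \<open>The part of parity \<open>\<sigma>\<close>, with a numbering \<open>\<beta>\<close> of its basis.\<close>

locale weil_part = additive_character F e \<psi>
  for F :: "'a::comm_ring set" and e and \<psi> +
  fixes \<sigma> :: complex and \<beta> :: "nat \<Rightarrow> 'a" and n :: nat
  assumes sigma: "\<sigma> = 1 \<or> \<sigma> = - 1"
    and bij: "bij_betw \<beta> {..<n} (parity_index \<sigma>)"
begin

abbreviation "I \<equiv> parity_index \<sigma>"

lemma sigma_sq [simp]: "\<sigma> * \<sigma> = 1" "\<sigma> * (\<sigma> * z) = z"
  using sigma by auto

lemma I_mem [simp]: "x \<in> I \<Longrightarrow> x \<in> F"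
  using half_subset by (auto simp: parity_index_def split: if_splits)

lemma I_zero: "0 \<in> I \<Longrightarrow> \<sigma> = 1"
  using half_subset by (auto simp: parity_index_def split: if_splits)

lemma I_uminus: "x \<in> I \<Longrightarrow> - x \<in> I \<Longrightarrow> x = 0"
  using half_cases[of x] half_subset by (auto simp: parity_index_def split: if_splits)

lemma I_square_eq: "x \<in> I \<Longrightarrow> y \<in> I \<Longrightarrow> x * x = y * y \<Longrightarrow> x = y"
  using square_eq_square[of x y] I_uminus[of y] by auto

lemma beta_mem [simp]: "i < n \<Longrightarrow> \<beta> i \<in> I"
  using bij by (auto simp: bij_betw_def)

lemma beta_inj: "i < n \<Longrightarrow> j < n \<Longrightarrow> \<beta> i = \<beta> j \<longleftrightarrow> i = j"
  using bij by (auto simp: bij_betw_def inj_on_def)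

lemma sum_beta: "(\<Sum>i<n. f (\<beta> i)) = (\<Sum>x\<in>I. f x)"
  by (rule sum.reindex_bij_betw[OF bij])

text \<open>
  The weight \<open>1 / 2\<close> at \<open>0\<close> compensates for \<open>0\<close> being its own negative, so that weighted sums over the index
  set are halves of sums over \<open>F\<close>.
\<close>

definition wt :: "'a \<Rightarrow> complex" where
  "wt y = (if y = 0 then 1 / 2 else 1)"

lemma sum_wt:
  fixes f :: "'a \<Rightarrow> complex"
  assumes "\<And>x. x \<in> F \<Longrightarrow> f (- x) = f x" and z: "\<sigma> = - 1 \<Longrightarrow> f 0 = 0"
  shows "(\<Sum>y\<in>I. wt y * f y) = (\<Sum>y\<in>F. f y) / 2"
proof -
  have h: "(\<Sum>y\<in>half. wt y * f y) = (\<Sum>y\<in>half. f y)"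
    using half_subset by (intro sum.cong) (auto simp: wt_def)
  have "0 \<notin> half" using half_subset by auto
  then have "(\<Sum>y\<in>insert 0 half. wt y * f y) = wt 0 * f 0 + (\<Sum>y\<in>half. f y)"
    by (simp add: h)
  then have "(\<Sum>y\<in>insert 0 half. wt y * f y) = f 0 / 2 + (\<Sum>y\<in>half. f y)"
    by (simp only: wt_def) simp
  with h show ?thesis
    using sigma z sum_even[of f, OF assms(1)] by (auto simp: parity_index_def field_simps)
qed

text \<open>The matrix coefficients with respect to the basis of the functions of parity \<open>\<sigma>\<close>.\<close>

definition part :: "'a \<times> 'a \<times> 'a \<times> 'a \<Rightarrow> 'a \<Rightarrow> 'a \<Rightarrow> complex" where
  "part g x y = wt y * (weil g x y + \<sigma> * weil g x (- y))"

lemma weil_uminus_left: "x \<in> F \<Longrightarrow> y \<in> F \<Longrightarrow> weil g (- x) y = weil g x (- y)"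
  using weil_uminus[of x "- y" g] by simp

lemma part_mult:
  assumes g: "g \<in> carrier sl2" and h: "h \<in> carrier sl2" and x: "x \<in> I" and z: "z \<in> I"
  shows "(\<Sum>y\<in>I. part g x y * part h y z) = part (g \<otimes>\<^bsub>sl2\<^esub> h) x z"
proof -
  define A where "A y = weil g x y + \<sigma> * weil g x (- y)" for y
  define B where "B y = weil h y z + \<sigma> * weil h y (- z)" for y
  have Am: "A (- y) = \<sigma> * A y" for y by (simp add: A_def distrib_left)
  have Bm: "B (- y) = \<sigma> * B y" if "y \<in> F" for y
    using that z by (simp add: B_def distrib_left weil_uminus_left)
  have A0: "A 0 = 0" if "\<sigma> = - 1" using that by (simp add: A_def)
  have AB: "A y * B y = weil g x y * weil h y z + \<sigma> * (weil g x y * weil h y (- z)) +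
      \<sigma> * (weil g x (- y) * weil h y z) + weil g x (- y) * weil h y (- z)" for y
    by (simp add: A_def B_def algebra_simps)
  have s3: "(\<Sum>y\<in>F. weil g x (- y) * weil h y z) = weil (g \<otimes>\<^bsub>sl2\<^esub> h) x (- z)"
  proof -
    have "(\<Sum>y\<in>F. weil g x (- y) * weil h y z) = (\<Sum>y\<in>F. weil g x y * weil h (- y) z)"
      using sum_uminus[of "\<lambda>y. weil g x y * weil h (- y) z"] by simp
    also have "\<dots> = (\<Sum>y\<in>F. weil g x y * weil h y (- z))"
      using z by (intro sum.cong) (simp_all add: weil_uminus_left)
    finally show ?thesis using weil_mult[OF g h, of x "- z"] x z by simp
  qed
  have s4: "(\<Sum>y\<in>F. weil g x (- y) * weil h y (- z)) = weil (g \<otimes>\<^bsub>sl2\<^esub> h) x z"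
  proof -
    have "(\<Sum>y\<in>F. weil g x (- y) * weil h y (- z)) = (\<Sum>y\<in>F. weil g x y * weil h (- y) (- z))"
      using sum_uminus[of "\<lambda>y. weil g x y * weil h (- y) (- z)"] by simp
    also have "\<dots> = (\<Sum>y\<in>F. weil g x y * weil h y z)"
      using z by (intro sum.cong) (simp_all add: weil_uminus)
    finally show ?thesis using weil_mult[OF g h, of x z] x z by simp
  qed
  have "(\<Sum>y\<in>I. part g x y * part h y z) = wt z * (\<Sum>y\<in>I. wt y * (A y * B y))"
    unfolding sum_distrib_left by (rule sum.cong) (simp_all add: part_def A_def B_def mult_ac)
  also have "(\<Sum>y\<in>I. wt y * (A y * B y)) = (\<Sum>y\<in>F. A y * B y) / 2"
    by (rule sum_wt) (simp_all add: Am Bm A0 mult_ac)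
  also have "(\<Sum>y\<in>F. A y * B y) = weil (g \<otimes>\<^bsub>sl2\<^esub> h) x z + \<sigma> * weil (g \<otimes>\<^bsub>sl2\<^esub> h) x (- z) +
      \<sigma> * weil (g \<otimes>\<^bsub>sl2\<^esub> h) x (- z) + weil (g \<otimes>\<^bsub>sl2\<^esub> h) x z"
    using weil_mult[OF g h, of x z] weil_mult[OF g h, of x "- z"] x z
    unfolding AB sum.distrib by (simp add: s3 s4 flip: sum_distrib_left)
  also have "wt z * ((weil (g \<otimes>\<^bsub>sl2\<^esub> h) x z + \<sigma> * weil (g \<otimes>\<^bsub>sl2\<^esub> h) x (- z) +
      \<sigma> * weil (g \<otimes>\<^bsub>sl2\<^esub> h) x (- z) + weil (g \<otimes>\<^bsub>sl2\<^esub> h) x z) / 2) = part (g \<otimes>\<^bsub>sl2\<^esub> h) x z"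
    by (simp add: part_def)
  finally show ?thesis .
qed

text \<open>The part of parity \<open>\<sigma>\<close> of the Weil representation, as matrices.\<close>

definition rho :: "'a \<times> 'a \<times> 'a \<times> 'a \<Rightarrow> complex mat" where
  "rho g = mat n n (\<lambda>(i, j). part g (\<beta> i) (\<beta> j))"

lemma rho_carrier [simp]: "rho g \<in> carrier_mat n n"
  by (simp add: rho_def)

lemma rho_dim [simp]: "dim_row (rho g) = n" "dim_col (rho g) = n"
  by (simp_all add: rho_def)

lemma rho_index [simp]: "i < n \<Longrightarrow> j < n \<Longrightarrow> rho g $$ (i, j) = part g (\<beta> i) (\<beta> j)"
  by (simp add: rho_def)

lemma rho_mult:
  assumes "g \<in> carrier sl2" "h \<in> carrier sl2"
  shows "rho (g \<otimes>\<^bsub>sl2\<^esub> h) = rho g * rho h"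
proof (rule eq_matI)
  fix i j assume "i < dim_row (rho g * rho h)" "j < dim_col (rho g * rho h)"
  then have ij: "i < n" "j < n" by auto
  have "(rho g * rho h) $$ (i, j) = (\<Sum>k<n. part g (\<beta> i) (\<beta> k) * part h (\<beta> k) (\<beta> j))"
    using ij by (simp add: scalar_prod_def atLeast0LessThan)
  also have "\<dots> = rho (g \<otimes>\<^bsub>sl2\<^esub> h) $$ (i, j)"
    using ij assms by (simp add: sum_beta[of "\<lambda>y. part g (\<beta> i) y * part h y (\<beta> j)"] part_mult)
  finally show "rho (g \<otimes>\<^bsub>sl2\<^esub> h) $$ (i, j) = (rho g * rho h) $$ (i, j)" ..
qed auto

lemma part_unipotent:
  assumes "b \<in> F" "x \<in> I" "y \<in> I"
  shows "part (e, b, 0, e) x y = (if x = y then \<psi> (b * (x * x)) else 0)"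
proof (cases "x = - y")
  case True
  then have "x = 0" "y = 0" using assms I_uminus[of y] by auto
  moreover have "\<sigma> = 1" using calculation assms I_zero by simp
  ultimately show ?thesis using assms unfolding part_def weil_def wt_def by simp
next
  case False
  then have "y \<noteq> - x" "y = 0 \<Longrightarrow> x \<noteq> y" by auto
  with False show ?thesis using assms by (auto simp: part_def weil_def wt_def)
qed

lemma rho_one: "rho \<one>\<^bsub>sl2\<^esub> = 1\<^sub>m n"
  by (rule eq_matI) (auto simp: part_unipotent beta_inj)

lemma representation_rho: "representation n sl2 rho"
proof -
  interpret group sl2 by (rule group_sl2)
  have "rho g \<in> Units (ring_mat TYPE(complex) n ())" if g: "g \<in> carrier sl2" for g
  proof -
    have "rho g * rho (inv\<^bsub>sl2\<^esub> g) = 1\<^sub>m n" "rho (inv\<^bsub>sl2\<^esub> g) * rho g = 1\<^sub>m n"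
      using g by (simp_all flip: rho_mult rho_one del: one_sl2)
    then show ?thesis unfolding Units_def ring_mat_def by (auto intro!: bexI[of _ "rho (inv\<^bsub>sl2\<^esub> g)"])
  qed
  then have "rho \<in> hom sl2 (units_of (ring_mat TYPE(complex) n ()))"
  proof (intro homI)
    fix g h assume "g \<in> carrier sl2" "h \<in> carrier sl2"
    then show "rho (g \<otimes>\<^bsub>sl2\<^esub> h) = rho g \<otimes>\<^bsub>units_of (ring_mat TYPE(complex) n ())\<^esub> rho h"
      by (simp add: rho_mult units_of_def ring_mat_def)
  qed (simp add: units_of_def)
  then show ?thesis unfolding representation_def GL_def .
qed

text \<open>
  The entry is a nonzero multiple of \<open>1 + \<sigma> * \<psi> (4 x y / c)\<close>. If \<open>x y \<noteq> 0\<close> this is nonzero for some \<open>c\<close>, as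
  \<open>\<psi>\<close> is not constantly \<open>- \<sigma>\<close> on the nonzero elements.
\<close>

lemma exists_part_lower_nonzero:
  assumes x: "x \<in> I" and y: "y \<in> I"
  shows "\<exists>c\<in>F. c \<noteq> 0 \<and> part (e, 0, c, e) x y \<noteq> 0"
proof -
  define w where "w = (x * y + x * y) + (x * y + x * y)"
  have w: "w \<in> F" using x y by (simp add: w_def)
  have "\<exists>k\<in>F. k \<noteq> 0 \<and> 1 + \<sigma> * \<psi> (k * w) \<noteq> 0"
  proof (cases "w = 0")
    case True
    then have "x = 0 \<or> y = 0" using x y unfolding w_def by simp
    then have "\<sigma> = 1" using x y I_zero by auto
    then show ?thesis using True by (intro bexI[of _ e]) auto
  next
    case False
    have "\<exists>u\<in>F. u \<noteq> 0 \<and> \<psi> u \<noteq> - \<sigma>"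
    proof (rule ccontr)
      assume "\<not> ?thesis"
      then have *: "\<psi> u = - \<sigma>" if "u \<in> F" "u \<noteq> 0" for u using that by auto
      obtain u where u: "u \<in> F" "\<psi> u \<noteq> 1" using psi_nontrivial by blast
      then have "u \<noteq> 0" by auto
      then have "\<psi> (u + u) = - \<sigma>" "\<psi> u = - \<sigma>" using * u by auto
      then have "\<sigma> * \<sigma> = - \<sigma>" using psi_add[of u u] u by simp
      then have "\<sigma> = - 1" by (metis sigma_sq(1) minus_minus)
      then show False using \<open>\<psi> u = - \<sigma>\<close> u by simp
    qed
    then obtain u where u: "u \<in> F" "u \<noteq> 0" "\<psi> u \<noteq> - \<sigma>" by blast
    have "finv w * u * w = (w * finv w) * u" by (simp only: mult_ac)
    then have "finv w * u * w = u" using w False u by simp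
    moreover have "1 + \<sigma> * \<psi> u \<noteq> 0" using u(3) sigma by (auto simp: add_eq_0_iff)
    ultimately show ?thesis using w False u by (intro bexI[of _ "finv w * u"]) auto
  qed
  then obtain k where k: "k \<in> F" "k \<noteq> 0" "1 + \<sigma> * \<psi> (k * w) \<noteq> 0" by blast
  define c where "c = finv k"
  have c: "c \<in> F" "c \<noteq> 0" "finv c = k" using k by (auto simp: c_def intro!: finv_unique)
  define P where "P = k * (x * x - (x * y + x * y) + y * y)"
  have P: "P \<in> F" using k x y by (simp add: P_def)
  have "weil (e, 0, c, e) x y = qchar c / gauss e * \<psi> P"
    using c x y by (simp add: weil_def P_def)
  moreover have "weil (e, 0, c, e) x (- y) = qchar c / gauss e * (\<psi> P * \<psi> (k * w))"
  proof -
    have "weil (e, 0, c, e) x (- y) =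
        qchar c / gauss e * \<psi> (k * (x * x + (x * y + x * y) + y * y))"
      using c x y k by (simp add: weil_def algebra_simps)
    also have "k * (x * x + (x * y + x * y) + y * y) = P + k * w"
      by (simp add: P_def w_def algebra_simps)
    finally show ?thesis using k w P by (simp add: psi_add)
  qed
  ultimately have "part (e, 0, c, e) x y = wt y * (qchar c / gauss e * \<psi> P * (1 + \<sigma> * \<psi> (k * w)))"
    by (simp only: part_def) (simp add: algebra_simps add_divide_distrib)
  moreover have "wt y \<noteq> 0" by (simp add: wt_def)
  ultimately show ?thesis using c k P by (intro bexI[of _ c]) auto
qed

text \<open>
  Averaging over the upper unipotent matrices against the character \<open>b \<mapsto> \<psi> (b * s)\<close>, with \<open>s\<close> the
  square of the basis index \<open>\<beta> i\<close>, projects onto the coordinate \<open>i\<close>, because the basis indices have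
  distinct squares.
\<close>

lemma unit_vec_mem:
  assumes W: "is_subspace n W"
    and inv: "\<And>b w. b \<in> F \<Longrightarrow> w \<in> W \<Longrightarrow> rho (e, b, 0, e) *\<^sub>v w \<in> W"
    and v: "v \<in> W" and i: "i < n" "v $ i \<noteq> 0"
  shows "unit_vec n i \<in> W"
proof -
  have vc: "v \<in> carrier_vec n" using v subspaceD(1)[OF W] by auto
  define s where "s = \<beta> i * \<beta> i"
  have s: "s \<in> F" using i by (simp add: s_def)
  have ent: "(rho (e, b, 0, e) *\<^sub>v v) $ k = \<psi> (b * (\<beta> k * \<beta> k)) * v $ k" if "b \<in> F" "k < n" for b k
  proof -
    have "(rho (e, b, 0, e) *\<^sub>v v) $ k = (\<Sum>j\<in>{0..<n}. rho (e, b, 0, e) $$ (k, j) * v $ j)"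
      using vc that by (simp add: scalar_prod_def)
    also have "\<dots> = (\<Sum>j\<in>{0..<n}. if j = k then \<psi> (b * (\<beta> k * \<beta> k)) * v $ k else 0)"
      using that by (intro sum.cong) (auto simp: part_unipotent beta_inj)
    finally show ?thesis using that by simp
  qed
  define f where "f b = \<psi> (- (b * s)) \<cdot>\<^sub>v (rho (e, b, 0, e) *\<^sub>v v)" for b
  have "f b \<in> W" if "b \<in> F" for b
    unfolding f_def using that inv v subspaceD(4)[OF W] by blast
  then have "vec n (\<lambda>k. \<Sum>b\<in>F. f b $ k) \<in> W" by (intro subspace_sum[OF W]) auto
  then have "(1 / (of_nat (card F) * v $ i)) \<cdot>\<^sub>v vec n (\<lambda>k. \<Sum>b\<in>F. f b $ k) \<in> W"
    by (rule subspaceD(4)[OF W])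
  also have "(1 / (of_nat (card F) * v $ i)) \<cdot>\<^sub>v vec n (\<lambda>k. \<Sum>b\<in>F. f b $ k) = unit_vec n i"
  proof (rule eq_vecI)
    fix k assume "k < dim_vec (unit_vec n i :: complex vec)"
    then have k: "k < n" by simp
    have "(\<Sum>b\<in>F. f b $ k) = (\<Sum>b\<in>F. v $ k * \<psi> ((\<beta> k * \<beta> k - s) * b))"
    proof (rule sum.cong)
      fix b assume b: "b \<in> F"
      have "\<psi> (- (b * s)) * \<psi> (b * (\<beta> k * \<beta> k)) = \<psi> ((\<beta> k * \<beta> k - s) * b)"
        using b s k by (simp add: algebra_simps flip: psi_add)
      then show "f b $ k = v $ k * \<psi> ((\<beta> k * \<beta> k - s) * b)"
      proof -
        have "f b $ k = \<psi> (- (b * s)) * (rho (e, b, 0, e) *\<^sub>v v) $ k"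
          unfolding f_def by (rule index_smult_vec) (use k in simp)
        also have "\<dots> = (\<psi> (- (b * s)) * \<psi> (b * (\<beta> k * \<beta> k))) * v $ k"
          unfolding ent[OF b k] by simp
        finally show ?thesis unfolding \<open>_ = \<psi> ((\<beta> k * \<beta> k - s) * b)\<close> by simp
      qed
    qed simp
    also have "\<dots> = v $ k * (\<Sum>b\<in>F. \<psi> ((\<beta> k * \<beta> k - s) * b))" by (simp add: sum_distrib_left)
    also have "(\<Sum>b\<in>F. \<psi> ((\<beta> k * \<beta> k - s) * b)) = (if k = i then of_nat (card F) else 0)"
    proof -
      have "\<beta> k * \<beta> k - s = 0 \<longleftrightarrow> k = i"
        using I_square_eq[of "\<beta> k" "\<beta> i"] k i beta_inj[of k i] by (auto simp: s_def)
      then show ?thesis using s k by (subst sum_psi) auto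
    qed
    finally show "((1 / (of_nat (card F) * v $ i)) \<cdot>\<^sub>v vec n (\<lambda>k. \<Sum>b\<in>F. f b $ k)) $ k = unit_vec n i $ k"
      using k i by (simp add: index_unit_vec)
  qed simp
  finally show ?thesis .
qed

lemma invariant_subspace_trivial:
  assumes W: "is_subspace n W"
    and upper: "\<And>b w. b \<in> F \<Longrightarrow> w \<in> W \<Longrightarrow> rho (e, b, 0, e) *\<^sub>v w \<in> W"
    and lower: "\<And>c w. c \<in> F \<Longrightarrow> w \<in> W \<Longrightarrow> rho (e, 0, c, e) *\<^sub>v w \<in> W"
  shows "W = {0\<^sub>v n} \<or> W = carrier_vec n"
proof (cases "W = {0\<^sub>v n}")
  case False
  then obtain v where v: "v \<in> W" "v \<noteq> 0\<^sub>v n" using subspaceD(2)[OF W] by auto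
  then have "v \<in> carrier_vec n" using subspaceD(1)[OF W] by auto
  then obtain i where i: "i < n" "v $ i \<noteq> 0"
    using v(2) by (metis carrier_vecD eq_vecI index_zero_vec(1) index_zero_vec(2))
  have ui: "unit_vec n i \<in> W" by (rule unit_vec_mem[OF W upper v(1) i])
  have uj: "unit_vec n j \<in> W" if j: "j < n" for j
  proof -
    obtain c where c: "c \<in> F" "part (e, 0, c, e) (\<beta> j) (\<beta> i) \<noteq> 0"
      using exists_part_lower_nonzero[of "\<beta> j" "\<beta> i"] i j by auto
    have "(rho (e, 0, c, e) *\<^sub>v unit_vec n i) $ j = part (e, 0, c, e) (\<beta> j) (\<beta> i)"
      using i j by (simp add: scalar_prod_right_unit)
    then show ?thesis using unit_vec_mem[OF W upper lower[OF c(1) ui] j] c by simp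
  qed
  have "w \<in> W" if w: "w \<in> carrier_vec n" for w
  proof -
    have "vec n (\<lambda>k. \<Sum>j<n. (w $ j \<cdot>\<^sub>v unit_vec n j) $ k) \<in> W"
      by (rule subspace_sum[OF W]) (use uj subspaceD(4)[OF W] in auto)
    also have "vec n (\<lambda>k. \<Sum>j<n. (w $ j \<cdot>\<^sub>v unit_vec n j) $ k) = w"
    proof (rule eq_vecI)
      fix k assume "k < dim_vec w"
      then have k: "k < n" using w by simp
      have "(\<Sum>j<n. (w $ j \<cdot>\<^sub>v unit_vec n j) $ k) = (\<Sum>j<n. if j = k then w $ k else 0)"
        using k by (intro sum.cong) (auto simp: index_unit_vec)
      then show "vec n (\<lambda>k. \<Sum>j<n. (w $ j \<cdot>\<^sub>v unit_vec n j) $ k) $ k = w $ k" using k by simp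
    qed (use w in simp)
    finally show ?thesis .
  qed
  then show ?thesis using subspaceD(1)[OF W] by auto
qed simp

lemma n_positive: "n > 0"
proof -
  have "I \<noteq> {}" by (simp add: parity_index_def)
  then show ?thesis using bij by (auto simp: bij_betw_def)
qed

lemma irreducible_rho: "irreducible_rep n sl2 rho"
  unfolding irreducible_rep_def
proof (intro conjI allI impI representation_rho n_positive)
  fix W assume "is_subspace n W \<and> (\<forall>g\<in>carrier sl2. \<forall>w\<in>W. rho g *\<^sub>v w \<in> W)"
  then show "W = {0\<^sub>v n} \<or> W = carrier_vec n"
    by (intro invariant_subspace_trivial) auto
qed

lemma character_rho:
  "character rho g = ((\<Sum>x\<in>F. weil g x x) + \<sigma> * (\<Sum>x\<in>F. weil g x (- x))) / 2"
proof -
  have "character rho g = (\<Sum>x\<in>I. wt x * (weil g x x + \<sigma> * weil g x (- x)))"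
    by (simp add: character_def sum_beta[of "\<lambda>x. part g x x"]) (simp add: part_def)
  also have "\<dots> = (\<Sum>x\<in>F. weil g x x + \<sigma> * weil g x (- x)) / 2"
    by (rule sum_wt) (use weil_uminus[of _ _ g] in \<open>auto simp: weil_uminus_left\<close>)
  finally show ?thesis by (simp add: sum.distrib sum_distrib_left)
qed

text \<open>
  For \<open>r = e\<close> this is the trace of the kernel of the matrix, for \<open>r = - e\<close> that of its composition with
  \<open>x \<mapsto> - x\<close>. If the trace of \<open>r\<close> times the matrix is not \<open>2\<close>, the value does not involve \<open>\<psi>\<close>.
\<close>

lemma sum_weil_diagonal:
  assumes g: "(a, b, c, d) \<in> carrier sl2" and r: "r = e \<or> r = - e" and tr: "r * (a + d) \<noteq> e + e"
  shows "(\<Sum>x\<in>F. weil (a, b, c, d) x (r * x)) = qchar (if c = 0 then a else a + d - (r + r))"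
proof -
  have F: "a \<in> F" "b \<in> F" "c \<in> F" "d \<in> F" and det: "a * d - b * c = e" using g by auto
  have rF: "r \<in> F" "r * r = e" using r by auto
  show ?thesis
  proof (cases "c = 0")
    case True
    have "a \<noteq> r"
    proof
      assume "a = r"
      moreover have "d = r" using det True rF finv_unique[of r d] finv_unique[of r r] F \<open>a = r\<close> by auto
      ultimately show False using tr rF by (simp add: distrib_left)
    qed
    then have "r * x = a * x \<longleftrightarrow> x = 0" if "x \<in> F" for x
      using mult_eq_zero[of "r - a" x] that F rF by (auto simp: left_diff_distrib)
    then have "(\<Sum>x\<in>F. weil (a, b, c, d) x (r * x)) = (\<Sum>x\<in>F. if x = 0 then qchar a else 0)"
      using True by (intro sum.cong) (auto simp: weil_def)
    then show ?thesis using True by simp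
  next
    case False
    define t where "t = finv c * (a + d - (r + r))"
    have "r * (a + d - (r + r)) = r * (a + d) - (e + e)"
      by (simp add: right_diff_distrib distrib_left rF)
    then have nz: "a + d - (r + r) \<noteq> 0" using tr by (metis mult_zero_right right_minus_eq)
    have t: "t \<in> F" "t \<noteq> 0" using nz F rF False by (auto simp: t_def)
    have "weil (a, b, c, d) x (r * x) = qchar c / gauss e * \<psi> (t * (x * x))" if x: "x \<in> F" for x
    proof -
      have "(r * x) * (r * x) = (r * r) * (x * x)" by (simp only: mult_ac)
      then have "(r * x) * (r * x) = x * x" using rF x by simp
      then have "a * (x * x) - (x * (r * x) + x * (r * x)) + d * ((r * x) * (r * x)) =
          (a + d - (r + r)) * (x * x)"
        by (simp add: algebra_simps)
      then show ?thesis using False by (simp add: weil_def t_def mult.assoc)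
    qed
    then have "(\<Sum>x\<in>F. weil (a, b, c, d) x (r * x)) = qchar c / gauss e * gauss t"
      by (simp add: gauss_def sum_distrib_left)
    also have "\<dots> = qchar c * qchar t" by (simp add: gauss_qchar[OF t])
    also have "qchar t = qchar c * qchar (a + d - (r + r))"
      unfolding t_def using nz F rF False by (subst qchar_mult) auto
    finally show ?thesis using False by (simp flip: mult.assoc)
  qed
qed

lemma character_rho_generic:
  assumes g: "(a, b, c, d) \<in> carrier sl2" and tr: "a + d \<noteq> e + e" "a + d \<noteq> - (e + e)"
  shows "character rho (a, b, c, d) = (qchar (if c = 0 then a else a + d - (e + e)) +
    \<sigma> * qchar (if c = 0 then a else a + d + (e + e))) / 2"
proof -
  have F: "a \<in> F" "d \<in> F" using g by auto
  have "(\<Sum>x\<in>F. weil (a, b, c, d) x x) = (\<Sum>x\<in>F. weil (a, b, c, d) x (e * x))"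
    by (rule sum.cong) auto
  moreover have "(\<Sum>x\<in>F. weil (a, b, c, d) x (- x)) = (\<Sum>x\<in>F. weil (a, b, c, d) x (- e * x))"
    by (rule sum.cong) auto
  moreover have "- e * (a + d) \<noteq> e + e" using F tr(2) by (metis add_mem e_mult minus_mult_left minus_minus)
  moreover have "a + d - (- e + - e) = a + d + (e + e)" by (simp add: algebra_simps)
  ultimately show ?thesis
    unfolding character_rho using sum_weil_diagonal[OF g, of e] sum_weil_diagonal[OF g, of "- e"] F tr
    by (simp only: e_mult add_mem) simp
qed

lemma weil_diagonal_matrix: "weil (a, 0, 0, d) x y = (if y = a * x then qchar a else 0)"
  by (simp add: weil_def)

end

section \<open>Primitivity\<close>

text \<open>
  In a direct sum only the zero family adds up to zero; the sum is taken coordinatewise.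
\<close>

lemma direct_sum_zero:
  assumes D: "direct_sum_decomposition n \<W>"
    and w: "\<And>W. W \<in> \<W> \<Longrightarrow> w W \<in> W"
    and sum: "\<And>i. i < n \<Longrightarrow> (\<Sum>W\<in>\<W>. w W $ i) = 0"
    and W: "W \<in> \<W>"
  shows "w W = 0\<^sub>v n"
proof -
  have finW: "finite \<W>" and sub: "\<And>W. W \<in> \<W> \<Longrightarrow> is_subspace n W"
    and uniq: "\<And>v. v \<in> carrier_vec n \<Longrightarrow>
      \<exists>!w. w \<in> (\<Pi>\<^sub>E W\<in>\<W>. W) \<and> v = finsum_vec TYPE(complex) n w \<W>"
    using D by (auto simp: direct_sum_decomposition_def)
  define w1 w2 where w1: "w1 = restrict w \<W>" and w2: "w2 = (\<lambda>W\<in>\<W>. 0\<^sub>v n :: complex vec)"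
  have P: "w1 \<in> (\<Pi>\<^sub>E W\<in>\<W>. W)" "w2 \<in> (\<Pi>\<^sub>E W\<in>\<W>. W)"
    using w subspaceD(2)[OF sub] by (auto simp: w1 w2)
  then have C: "w1 \<in> \<W> \<rightarrow> carrier_vec n" "w2 \<in> \<W> \<rightarrow> carrier_vec n"
    using subspaceD(1)[OF sub] by (auto simp: PiE_def Pi_def)
  have e1: "0\<^sub>v n = finsum_vec TYPE(complex) n w1 \<W>"
  proof (rule eq_vecI)
    fix i assume "i < dim_vec (finsum_vec TYPE(complex) n w1 \<W>)"
    then have i: "i < n" using finsum_vec_closed[OF C(1)] by simp
    then show "0\<^sub>v n $ i = finsum_vec TYPE(complex) n w1 \<W> $ i"
      using sum by (simp add: index_finsum_vec[OF finW i C(1)]) (simp add: w1)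
  qed (use finsum_vec_closed[OF C(1)] in simp)
  have e2: "0\<^sub>v n = finsum_vec TYPE(complex) n w2 \<W>"
  proof (rule eq_vecI)
    fix i assume "i < dim_vec (finsum_vec TYPE(complex) n w2 \<W>)"
    then have i: "i < n" using finsum_vec_closed[OF C(2)] by simp
    then show "0\<^sub>v n $ i = finsum_vec TYPE(complex) n w2 \<W> $ i"
      by (simp add: index_finsum_vec[OF finW i C(2)]) (simp add: w2)
  qed (use finsum_vec_closed[OF C(2)] in simp)
  have "w1 = w2" using uniq[OF zero_carrier_vec] P e1 e2 by blast
  then show ?thesis using W by (metis restrict_apply' w1 w2)
qed

lemma card_direct_sum_le:
  assumes D: "direct_sum_decomposition n \<W>"
  shows "card \<W> \<le> n"
proof -
  have finW: "finite \<W>" and sub: "\<And>W. W \<in> \<W> \<Longrightarrow> is_subspace n W"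
    and nz: "\<And>W. W \<in> \<W> \<Longrightarrow> W \<noteq> {0\<^sub>v n}"
    using D by (auto simp: direct_sum_decomposition_def)
  define f where "f W = (SOME v. v \<in> W \<and> v \<noteq> 0\<^sub>v n)" for W :: "complex vec set"
  have f: "f W \<in> W \<and> f W \<noteq> 0\<^sub>v n" if "W \<in> \<W>" for W
    unfolding f_def by (rule someI_ex) (use subspaceD(2)[OF sub[OF that]] nz[OF that] in blast)
  have fc: "f W \<in> carrier_vec n" if "W \<in> \<W>" for W
    using f[OF that] subspaceD(1)[OF sub[OF that]] by auto
  have fd: "dim_vec (f W) = n" if "W \<in> \<W>" for W
    using fc[OF that] by simp
  have inj: "inj_on f \<W>"
  proof (rule inj_onI, rule ccontr)
    fix W W' assume W: "W \<in> \<W>" "W' \<in> \<W>" "f W = f W'" "W \<noteq> W'"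
    define w where "w Z = (if Z = W then f W else if Z = W' then (- 1) \<cdot>\<^sub>v f W else 0\<^sub>v n)" for Z
    have "w W = 0\<^sub>v n"
    proof (rule direct_sum_zero[OF D])
      show "w Z \<in> Z" if "Z \<in> \<W>" for Z
        using f[OF W(1)] f[OF W(2)] W(3) subspaceD(2)[OF sub[OF that]] subspaceD(4)[OF sub[OF that]]
        by (auto simp: w_def)
      show "(\<Sum>Z\<in>\<W>. w Z $ i) = 0" if i: "i < n" for i
      proof -
        have "(\<Sum>Z\<in>\<W>. w Z $ i) = (\<Sum>Z\<in>\<W>. (if Z = W then f W $ i else 0) + (if Z = W' then - (f W $ i) else 0))"
          using i W fc[OF W(1)] by (intro sum.cong) (auto simp: w_def)
        also have "\<dots> = 0" using finW W by (simp add: sum.distrib sum.delta)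
        finally show ?thesis .
      qed
    qed (rule W)
    then show False using f[OF W(1)] by (simp add: w_def)
  qed
  interpret vec_space "TYPE(complex)" n .
  have "lin_indpt (f ` \<W>)"
  proof
    assume "lin_dep (f ` \<W>)"
    then obtain A a v where A: "finite A" "A \<subseteq> f ` \<W>" "lincomb a A = 0\<^sub>v n" "v \<in> A" "a v \<noteq> 0"
      unfolding lin_dep_def by auto
    have AC: "A \<subseteq> carrier_vec n" using A(2) fc by auto
    define w where "w Z = (if f Z \<in> A then a (f Z) \<cdot>\<^sub>v f Z else 0\<^sub>v n)" for Z
    obtain W where W: "W \<in> \<W>" "v = f W" using A by auto
    have "w W = 0\<^sub>v n"
    proof (rule direct_sum_zero[OF D])
      show "w Z \<in> Z" if "Z \<in> \<W>" for Z
        using f[OF that] subspaceD(2)[OF sub[OF that]] subspaceD(4)[OF sub[OF that]]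
        by (auto simp: w_def)
      show "(\<Sum>Z\<in>\<W>. w Z $ i) = 0" if i: "i < n" for i
      proof -
        have "(\<Sum>Z\<in>\<W>. w Z $ i) = (\<Sum>Z\<in>\<W>. if f Z \<in> A then a (f Z) * f Z $ i else 0)"
          using i by (intro sum.cong) (auto simp: w_def fd)
        also have "\<dots> = (\<Sum>u\<in>f ` \<W>. if u \<in> A then a u * u $ i else 0)"
          using sum.reindex[OF inj, of "\<lambda>u. if u \<in> A then a u * u $ i else 0"] by simp
        also have "\<dots> = (\<Sum>u\<in>A. a u * u $ i)"
          using A(2) finW by (subst sum.inter_restrict[symmetric]) (auto simp: Int_absorb1)
        also have "\<dots> = lincomb a A $ i" using lincomb_index[OF i AC] by simp
        finally show ?thesis using A(3) i by simp
      qed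
    qed (rule W)
    then have 0: "a v \<cdot>\<^sub>v v = 0\<^sub>v n" using A(4) W by (simp add: w_def)
    have "v = 0\<^sub>v n"
    proof (rule eq_vecI)
      fix i assume "i < dim_vec (0\<^sub>v n :: complex vec)"
      then have i: "i < n" by simp
      have "(a v \<cdot>\<^sub>v v) $ i = a v * v $ i" using fc[OF W(1)] W(2) i by simp
      then show "v $ i = 0\<^sub>v n $ i" using A(5) i by (simp add: 0)
    qed (use fc[OF W(1)] W(2) in simp)
    then show False using f[OF W(1)] W(2) by simp
  qed
  then have "card (f ` \<W>) \<le> dim"
    using li_le_dim(2)[OF fin_dim, of "f ` \<W>"] fc by auto
  then show ?thesis by (simp add: card_image[OF inj] dim_is_n)
qed

context additive_character
begin

text \<open>
  Let the additive group of \<open>F\<close> act by \<open>\<pi>\<close> on a set \<open>S\<close> of at most \<open>(q + 1) / 2\<close> points, such that \<open>\<pi> b\<close> and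
  \<open>\<pi> (a\<^sup>2 b)\<close> are conjugate by a permutation \<open>\<tau> a\<close>. Then the action is trivial. For a point \<open>x\<close> let \<open>A x\<close> be
  its stabilizer, \<open>Orb x\<close> its orbit, and \<open>D x\<close> the set of \<open>t\<close> such that \<open>b \<mapsto> \<psi> (t b)\<close> is trivial on \<open>A x\<close>. By
  duality \<open>D x\<close> has as many elements as the orbit. If \<open>x\<close> is moved, then a nonzero \<open>t \<in> D x\<close> exists, and it gives \<open>t / a\<^sup>2 \<in> D (\<tau> a x)\<close> for each of
  the \<open>(q - 1) / 2\<close> elements \<open>a\<close> modulo sign, so the sum of the numbers \<open>card o' - 1\<close> over all orbits \<open>o'\<close> is at
  least \<open>(q - 1) / 2\<close>. This leaves a single orbit, of \<open>(q + 1) / 2\<close> elements, a number that would have to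
  divide \<open>q\<close>.
\<close>

lemma translation_action_trivial:
  fixes \<pi> \<tau> :: "'a \<Rightarrow> 'x \<Rightarrow> 'x"
  assumes S: "finite S" "card S \<le> card half + 1"
    and \<pi>: "\<And>b x. b \<in> F \<Longrightarrow> x \<in> S \<Longrightarrow> \<pi> b x \<in> S" "\<And>x. x \<in> S \<Longrightarrow> \<pi> 0 x = x"
      "\<And>b b' x. b \<in> F \<Longrightarrow> b' \<in> F \<Longrightarrow> x \<in> S \<Longrightarrow> \<pi> (b + b') x = \<pi> b (\<pi> b' x)"
    and \<tau>: "\<And>a x. a \<in> F \<Longrightarrow> a \<noteq> 0 \<Longrightarrow> x \<in> S \<Longrightarrow> \<tau> a x \<in> S"
      "\<And>a. a \<in> F \<Longrightarrow> a \<noteq> 0 \<Longrightarrow> inj_on (\<tau> a) S"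
      "\<And>a b x. a \<in> F \<Longrightarrow> a \<noteq> 0 \<Longrightarrow> b \<in> F \<Longrightarrow> x \<in> S \<Longrightarrow> \<tau> a (\<pi> b x) = \<pi> (a * a * b) (\<tau> a x)"
    and b: "b \<in> F" and x: "x \<in> S"
  shows "\<pi> b x = x"
proof (rule ccontr)
  assume nontriv: "\<pi> b x \<noteq> x"
  define A where "A x = {b \<in> F. \<pi> b x = x}" for x
  define Orb where "Orb x = (\<lambda>b. \<pi> b x) ` F" for x
  define D where "D x = {t \<in> F. \<forall>b\<in>A x. \<psi> (t * b) = 1}" for x
  have A0: "0 \<in> A x" if "x \<in> S" for x using that \<pi> by (simp add: A_def)
  have AF: "A x \<subseteq> F" for x by (auto simp: A_def)
  have finA [simp]: "finite (A x)" for x using finite_subset[OF AF] by simp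
  have Aadd: "b + b' \<in> A x" if "x \<in> S" "b \<in> A x" "b' \<in> A x" for x b b'
    using that \<pi> by (simp add: A_def)
  have Aminus: "- b \<in> A x" if "x \<in> S" "b \<in> A x" for x b
    using that \<pi>(3)[of "- b" b x] \<pi>(2)[of x] by (simp add: A_def)
  have undo: "\<pi> (- b) (\<pi> b x) = x" if "x \<in> S" "b \<in> F" for x b
    using that \<pi>(3)[of "- b" b x] \<pi>(2)[of x] by simp
  have cardA: "card (A x) > 0" if "x \<in> S" for x using A0[OF that] by (auto simp: card_gt_0_iff)
  have orbit: "card (Orb x) * card (A x) = card F" if x: "x \<in> S" for x
  proof -
    have fiber: "card {b \<in> F. \<pi> b x = y} = card (A x)" if y: "y \<in> Orb x" for y
    proof -
      obtain c where c: "c \<in> F" "y = \<pi> c x" using y by (auto simp: Orb_def)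
      have "bij_betw (\<lambda>b. c + b) (A x) {b \<in> F. \<pi> b x = y}"
      proof (rule bij_betwI[of _ _ _ "\<lambda>b. - c + b"])
        show "(\<lambda>b. c + b) \<in> A x \<rightarrow> {b \<in> F. \<pi> b x = y}"
          using c x \<pi> by (auto simp: A_def)
        show "(\<lambda>b. - c + b) \<in> {b \<in> F. \<pi> b x = y} \<rightarrow> A x"
        proof
          fix b assume "b \<in> {b \<in> F. \<pi> b x = y}"
          then have "b \<in> F" "\<pi> b x = \<pi> c x" using c by auto
          then have "\<pi> (- c + b) x = x" using \<pi>(3)[of "- c" b x] undo[OF x c(1)] c x by simp
          then show "- c + b \<in> A x" using \<open>b \<in> F\<close> c add_mem[of "- c" b] by (simp add: A_def)
        qed
      qed auto
      then show ?thesis by (metis bij_betw_same_card)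
    qed
    have "card F = (\<Sum>b\<in>F. 1)" by simp
    also have "\<dots> = (\<Sum>y\<in>Orb x. \<Sum>b\<in>{b \<in> F. \<pi> b x = y}. 1)"
      unfolding Orb_def by (rule sum.image_gen) simp
    also have "\<dots> = (\<Sum>y\<in>Orb x. card (A x))" using fiber by (intro sum.cong) simp_all
    finally show ?thesis by simp
  qed
  have dual: "card (D x) * card (A x) = card F" if x: "x \<in> S" for x
  proof -
    have inner: "(\<Sum>b\<in>A x. \<psi> (t * b)) = (if t \<in> D x then of_nat (card (A x)) else 0)"
      if t: "t \<in> F" for t
    proof (cases "t \<in> D x")
      case True
      then show ?thesis by (simp add: D_def)
    next
      case False
      then obtain c where c: "c \<in> A x" "\<psi> (t * c) \<noteq> 1" using t by (auto simp: D_def)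
      have "(\<Sum>b\<in>A x. \<psi> (t * b)) = (\<Sum>b\<in>A x. \<psi> (t * (b + c)))"
        by (rule sum.reindex_bij_witness[of _ "\<lambda>b. b + c" "\<lambda>b. b - c"])
          (use c Aadd[OF x] Aminus[OF x] in \<open>auto simp: diff_conv_add_uminus simp del: add_uminus_conv_diff\<close>)
      also have "\<dots> = (\<Sum>b\<in>A x. \<psi> (t * b) * \<psi> (t * c))"
        using t c AF[of x] by (intro sum.cong) (auto simp: distrib_left psi_add subset_iff)
      also have "\<dots> = (\<Sum>b\<in>A x. \<psi> (t * b)) * \<psi> (t * c)" by (simp add: sum_distrib_right)
      finally show ?thesis using c False by (auto simp: field_simps)
    qed
    have "of_nat (card (D x) * card (A x)) = (\<Sum>t\<in>F. if t \<in> D x then of_nat (card (A x)) else 0 :: complex)"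
    proof -
      have "D x \<subseteq> F" by (auto simp: D_def)
      then show ?thesis by (subst sum.inter_restrict[symmetric]) (auto simp: Int_absorb1)
    qed
    also have "\<dots> = (\<Sum>t\<in>F. \<Sum>b\<in>A x. \<psi> (t * b))" by (intro sum.cong) (simp_all add: inner)
    also have "\<dots> = (\<Sum>b\<in>A x. \<Sum>t\<in>F. \<psi> (b * t))"
      by (subst sum.swap) (simp add: mult.commute)
    also have "\<dots> = (\<Sum>b\<in>A x. if b = 0 then of_nat (card F) else 0)"
      using AF[of x] by (intro sum.cong) (auto simp: sum_psi subset_iff)
    also have "\<dots> = of_nat (card F)" using A0[OF x] by simp
    finally show ?thesis by (simp only: of_nat_eq_iff)
  qed
  have cardD: "card (D x) = card (Orb x)" if "x \<in> S" for x
    using orbit[OF that] dual[OF that] cardA[OF that] by (metis mult_right_cancel not_gr0)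
  have OX: "Orb x \<subseteq> S" if "x \<in> S" for x using that \<pi> by (auto simp: Orb_def)
  have self: "x \<in> Orb x" if "x \<in> S" for x
    unfolding Orb_def using \<pi>(2)[OF that] by (intro image_eqI[of _ _ 0]) auto
  have Osub: "Orb y \<subseteq> Orb x" if x: "x \<in> S" and y: "y \<in> Orb x" for x y
  proof -
    obtain c where c: "c \<in> F" "y = \<pi> c x" using y by (auto simp: Orb_def)
    then have "\<pi> b y = \<pi> (b + c) x" if "b \<in> F" for b using that x \<pi> by simp
    then show ?thesis using c by (auto simp: Orb_def)
  qed
  have Oeq: "Orb y = Orb x" if x: "x \<in> S" and y: "y \<in> Orb x" for x y
  proof
    show "Orb y \<subseteq> Orb x" by (rule Osub[OF x y])
    obtain c where c: "c \<in> F" "y = \<pi> c x" using y by (auto simp: Orb_def)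
    have "x \<in> Orb y" unfolding Orb_def using undo[OF x c(1)] c by (intro image_eqI[of _ _ "- c"]) auto
    then show "Orb x \<subseteq> Orb y" using Osub[of y x] OX[OF x] y by auto
  qed
  have Deq: "D y = D x" if x: "x \<in> S" and y: "y \<in> Orb x" for x y
  proof -
    have yX: "y \<in> S" using OX[OF x] y by auto
    have "A z \<subseteq> A w" if z: "z \<in> S" and w: "w \<in> Orb z" for z w
    proof
      fix b assume b: "b \<in> A z"
      obtain c where c: "c \<in> F" "w = \<pi> c z" using w by (auto simp: Orb_def)
      have "\<pi> b w = \<pi> c (\<pi> b z)"
        using \<pi>(3)[of b c z] \<pi>(3)[of c b z] b c z by (simp add: A_def add.commute)
      then show "b \<in> A w" using b c by (simp add: A_def)
    qed
    then have "A y = A x" using Oeq[OF x y] self x y yX by blast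
    then show ?thesis by (simp add: D_def)
  qed
  have "A x \<noteq> F" using nontriv b by (auto simp: A_def)
  then have "card (A x) < card F" by (simp add: AF psubsetI psubset_card_mono)
  then have "card (D x) \<noteq> 1" using dual[OF x] by auto
  moreover have D0: "0 \<in> D z" for z by (simp add: D_def)
  ultimately have "D x \<noteq> {0}" by auto
  then obtain t where t: "t \<in> D x" "t \<noteq> 0" using D0 by blast
  have tF: "t \<in> F" using t by (simp add: D_def)
  \<comment> \<open>\<open>r\<close> picks a representative of every orbit\<close>
  define r where "r o' = (SOME z. z \<in> o')" for o' :: "'x set"
  have r: "r (Orb z) \<in> Orb z" if "z \<in> S" for z
    unfolding r_def by (rule someI[of "\<lambda>y. y \<in> Orb z", OF self[OF that]])
  define \<O> where "\<O> = Orb ` S"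
  have finO: "finite \<O>" using S by (simp add: \<O>_def)
  define g where "g a = t * finv (a * a)" for a
  have sq: "a * a \<in> F" "a * a \<noteq> 0" if "a \<in> half" for a
    using that half_subset by auto
  have "g ` half \<subseteq> (\<Union>o'\<in>\<O>. D (r o') - {0})"
  proof
    fix s assume "s \<in> g ` half"
    then obtain a where a: "a \<in> half" "s = g a" by blast
    then have aF: "a \<in> F" "a \<noteq> 0" using half_subset by auto
    define y where "y = \<tau> a x"
    have y: "y \<in> S" using \<tau>(1) aF x by (simp add: y_def)
    have "\<psi> (g a * c) = 1" if c: "c \<in> A y" for c
    proof -
      define d where "d = finv (a * a) * c"
      have cF: "c \<in> F" using c by (simp add: A_def)
      have d: "d \<in> F" "a * a * d = c" using sq[OF a(1)] cF by (simp_all add: d_def)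
      have "\<tau> a (\<pi> d x) = \<tau> a x" using \<tau>(3)[OF aF d(1) x] d(2) c by (simp add: A_def y_def)
      then have "\<pi> d x = x" using inj_onD[OF \<tau>(2)[OF aF]] \<pi>(1)[OF d(1) x] x by blast
      then have "\<psi> (t * d) = 1" using t d by (simp add: D_def A_def)
      then show ?thesis by (simp add: g_def d_def mult.assoc)
    qed
    then have "g a \<in> D y" using sq[OF a(1)] tF by (simp add: D_def g_def)
    moreover have "g a \<noteq> 0" using sq[OF a(1)] tF t by (simp add: g_def)
    moreover have "D (r (Orb y)) = D y" by (rule Deq[OF y r[OF y]])
    ultimately show "s \<in> (\<Union>o'\<in>\<O>. D (r o') - {0})" using y a by (auto simp: \<O>_def)
  qed
  then have "card (g ` half) \<le> card (\<Union>o'\<in>\<O>. D (r o') - {0})"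
    by (intro card_mono) (use finO in \<open>auto simp: D_def\<close>)
  also have "\<dots> \<le> (\<Sum>o'\<in>\<O>. card (D (r o') - {0}))" by (rule card_UN_le[OF finO])
  also have "\<dots> = (\<Sum>o'\<in>\<O>. card o' - 1)"
  proof (rule sum.cong)
    fix o' assume "o' \<in> \<O>"
    then obtain z where z: "z \<in> S" "o' = Orb z" by (auto simp: \<O>_def)
    have "card (D (r o')) = card o'" using Deq[OF z(1) r[OF z(1)]] cardD[OF z(1)] z by simp
    moreover have "finite (D (r o'))" by (simp add: D_def)
    ultimately show "card (D (r o') - {0}) = card o' - 1" using D0 by simp
  qed simp
  also have "card (g ` half) = card half"
  proof (rule card_image, rule inj_onI)
    fix a a' assume a: "a \<in> half" "a' \<in> half" "g a = g a'"
    then have "finv (a * a) = finv (a' * a')"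
      using mult_left_cancel[OF tF t(2)] sq by (simp add: g_def)
    then have "a * a = a' * a'"
    proof -
      have ff: "finv (finv z) = z" if "z \<in> F" "z \<noteq> 0" for z
        using finv_unique[of "finv z" z] that by simp
      have "finv (finv (a * a)) = finv (finv (a' * a'))"
        by (simp only: \<open>finv (a * a) = finv (a' * a')\<close>)
      then show ?thesis by (simp only: ff[OF sq[OF a(1)]] ff[OF sq[OF a(2)]])
    qed
    then show "a = a'" using inj_onD[OF inj_on_square_half, of a a'] a by blast
  qed
  finally have le: "card half \<le> (\<Sum>o'\<in>\<O>. card o' - 1)" .
  have "disjoint \<O>"
  proof (unfold disjoint_def, intro ballI impI)
    fix P Q assume PQ: "P \<in> \<O>" "Q \<in> \<O>" "P \<noteq> Q"
    then obtain y z where yz: "y \<in> S" "P = Orb y" "z \<in> S" "Q = Orb z" by (auto simp: \<O>_def)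
    show "P \<inter> Q = {}"
    proof (rule ccontr)
      assume "P \<inter> Q \<noteq> {}"
      then obtain u where "u \<in> Orb y" "u \<in> Orb z" using yz by auto
      then show False using Oeq[OF yz(1)] Oeq[OF yz(3)] PQ(3) yz by metis
    qed
  qed
  have "\<Union>\<O> = S" using OX self by (auto simp: \<O>_def)
  moreover have finO': "finite P" if "P \<in> \<O>" for P
    using that by (auto simp: \<O>_def Orb_def)
  ultimately have cX: "card S = (\<Sum>o'\<in>\<O>. card o')"
    using card_Union_disjoint[of \<O>] \<open>disjoint \<O>\<close>
    by (auto simp: disjoint_def pairwise_def disjnt_def)
  have "card o' \<ge> 1" if "o' \<in> \<O>" for o'
    using that self finO'[OF that] by (auto simp: \<O>_def Suc_le_eq card_gt_0_iff)
  then have "(\<Sum>o'\<in>\<O>. card o') = (\<Sum>o'\<in>\<O>. (card o' - 1) + 1)"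
    by (intro sum.cong refl le_add_diff_inverse2[symmetric])
  also have "\<dots> = (\<Sum>o'\<in>\<O>. card o' - 1) + card \<O>" by (simp only: sum.distrib) simp
  finally have "card half + card \<O> \<le> card S" using le cX by linarith
  moreover have Ox: "Orb x \<in> \<O>" using x by (simp add: \<O>_def)
  then have "card \<O> \<ge> 1" using finO by (auto simp: Suc_le_eq card_gt_0_iff)
  ultimately have "card \<O> = 1" and cX': "card S = card half + 1" using S(2) by linarith+
  then have "\<O> = {Orb x}" using Ox by (metis card_1_singletonE singletonD)
  then have "card S = card (Orb x)" using cX by simp
  then have "card S dvd card F" using orbit[OF x] by (metis dvd_triv_left)
  moreover have "card F + 1 = 2 * card S" using card_F cX' by simp
  \<comment> \<open>\<open>card S\<close> divides both \<open>q\<close> and \<open>q + 1\<close>\<close>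
  ultimately have "card S dvd 1"
    using dvd_add_right_iff[of "card S" "card F" 1] by simp
  then have "half = {}" using cX' by simp
  then show False by simp
qed

end

context weil_part
begin

lemma n_le: "n \<le> card half + 1"
proof -
  have "n = card I" using bij_betw_same_card[OF bij] by simp
  also have "\<dots> \<le> card half + 1" by (simp add: parity_index_def card_insert_if)
  finally show ?thesis .
qed

text \<open>The action on sets of vectors, in particular on the blocks of a decomposition.\<close>

definition act :: "'a \<times> 'a \<times> 'a \<times> 'a \<Rightarrow> complex vec set \<Rightarrow> complex vec set" where
  "act g W = (\<lambda>v. rho g *\<^sub>v v) ` W"

lemma act_mult:
  assumes "g \<in> carrier sl2" "h \<in> carrier sl2" "W \<subseteq> carrier_vec n"
  shows "act (g \<otimes>\<^bsub>sl2\<^esub> h) W = act g (act h W)"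
proof -
  have "rho (g \<otimes>\<^bsub>sl2\<^esub> h) *\<^sub>v v = rho g *\<^sub>v (rho h *\<^sub>v v)" if "v \<in> W" for v
    using assms that
    by (simp add: rho_mult assoc_mult_mat_vec[OF rho_carrier rho_carrier] subset_iff)
  then show ?thesis by (force simp: act_def image_image)
qed

lemma act_one: "W \<subseteq> carrier_vec n \<Longrightarrow> act \<one>\<^bsub>sl2\<^esub> W = W"
  unfolding act_def rho_one by (force simp: subset_iff)

lemma primitive_rho: "primitive_rep n sl2 rho"
  unfolding primitive_rep_def
proof
  show "irreducible_rep n sl2 rho" by (rule irreducible_rho)
  show "\<not> imprimitive_rep n sl2 rho"
  proof
    assume "imprimitive_rep n sl2 rho"
    then obtain \<W> where D: "direct_sum_decomposition n \<W>" and two: "card \<W> \<ge> 2"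
      and perm: "\<And>g W. g \<in> carrier sl2 \<Longrightarrow> W \<in> \<W> \<Longrightarrow> act g W \<in> \<W>"
      unfolding imprimitive_rep_def act_def by blast
    have fin: "finite \<W>" and sub: "\<And>W. W \<in> \<W> \<Longrightarrow> is_subspace n W"
      and nz: "\<And>W. W \<in> \<W> \<Longrightarrow> W \<noteq> {0\<^sub>v n}"
      using D by (auto simp: direct_sum_decomposition_def)
    have C: "W \<subseteq> carrier_vec n" if "W \<in> \<W>" for W using subspaceD(1)[OF sub[OF that]] .
    have mult: "act (g \<otimes>\<^bsub>sl2\<^esub> h) W = act g (act h W)"
      if "g \<in> carrier sl2" "h \<in> carrier sl2" "W \<in> \<W>" for g h W
      using act_mult[OF that(1,2) C[OF that(3)]] .
    interpret group sl2 by (rule group_sl2)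
    have upper: "act (e, b, 0, e) W = W" if b: "b \<in> F" and W: "W \<in> \<W>" for b W
    proof (rule translation_action_trivial[where S = \<W> and \<pi> = "\<lambda>b. act (e, b, 0, e)"
          and \<tau> = "\<lambda>a. act (a, 0, 0, finv a)", OF fin])
      show "card \<W> \<le> card half + 1" using card_direct_sum_le[OF D] n_le by linarith
      show "act (e, b, 0, e) W \<in> \<W>" if "b \<in> F" "W \<in> \<W>" for b W using that by (intro perm) auto
      show "act (e, 0, 0, e) W = W" if "W \<in> \<W>" for W using act_one[OF C[OF that]] by simp
      show "act (e, b + b', 0, e) W = act (e, b, 0, e) (act (e, b', 0, e) W)"
        if "b \<in> F" "b' \<in> F" "W \<in> \<W>" for b b' W
        using mult[of "(e, b, 0, e)" "(e, b', 0, e)" W] that by (simp add: add.commute)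
      show "act (a, 0, 0, finv a) W \<in> \<W>" if "a \<in> F" "a \<noteq> 0" "W \<in> \<W>" for a W
        using that by (intro perm) auto
      show "inj_on (act (a, 0, 0, finv a)) \<W>" if a: "a \<in> F" "a \<noteq> 0" for a
      proof (rule inj_on_inverseI[where g = "act (finv a, 0, 0, a)"])
        fix W assume W: "W \<in> \<W>"
        have "act (finv a, 0, 0, a) (act (a, 0, 0, finv a) W) = act \<one>\<^bsub>sl2\<^esub> W"
          using mult[of "(finv a, 0, 0, a)" "(a, 0, 0, finv a)" W] a W by simp
        then show "act (finv a, 0, 0, a) (act (a, 0, 0, finv a) W) = W"
          using act_one[OF C[OF W]] by simp
      qed
      show "act (a, 0, 0, finv a) (act (e, b, 0, e) W) = act (e, a * a * b, 0, e) (act (a, 0, 0, finv a) W)"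
        if "a \<in> F" "a \<noteq> 0" "b \<in> F" "W \<in> \<W>" for a b W
      proof -
        have "a * a * b * finv a = (a * finv a) * (a * b)" by (simp only: mult_ac)
        then have "a * a * b * finv a = a * b" using that by simp
        then show ?thesis
          using mult[of "(a, 0, 0, finv a)" "(e, b, 0, e)" W]
            mult[of "(e, a * a * b, 0, e)" "(a, 0, 0, finv a)" W] that by simp
      qed
    qed (use b W in auto)
    have lower: "act (e, 0, c, e) W = W" if c: "c \<in> F" and W: "W \<in> \<W>" for c W
    proof -
      \<comment> \<open>the Weyl element conjugates upper into lower unipotent matrices\<close>
      define w w' where w: "w = (0 :: 'a, - e, e, 0 :: 'a)" and w': "w' = (0 :: 'a, e, - e, 0 :: 'a)"
      have S: "w \<in> carrier sl2" "w' \<in> carrier sl2" "(e, - c, 0, e) \<in> carrier sl2"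
        using c by (auto simp: w w')
      have w'W: "act w' W \<in> \<W>" by (rule perm[OF S(2) W])
      have "(e, 0, c, e) = w \<otimes>\<^bsub>sl2\<^esub> ((e, - c, 0, e) \<otimes>\<^bsub>sl2\<^esub> w')"
        using c by (simp add: w w')
      then have "act (e, 0, c, e) W = act w (act (e, - c, 0, e) (act w' W))"
        using mult[OF S(1) m_closed[OF S(3,2)] W] mult[OF S(3,2) W] by simp
      also have "act (e, - c, 0, e) (act w' W) = act w' W" using c w'W by (intro upper) auto
      also have "act w (act w' W) = act (w \<otimes>\<^bsub>sl2\<^esub> w') W" using mult[OF S(1,2) W] by simp
      also have "w \<otimes>\<^bsub>sl2\<^esub> w' = \<one>\<^bsub>sl2\<^esub>" by (simp add: w w')
      also have "act \<one>\<^bsub>sl2\<^esub> W = W" by (rule act_one[OF C[OF W]])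
      finally show ?thesis .
    qed
    have "W = carrier_vec n" if W: "W \<in> \<W>" for W
    proof -
      have "rho (e, b, 0, e) *\<^sub>v w \<in> W" if "b \<in> F" "w \<in> W" for b w
        using upper[OF that(1) W] that(2) unfolding act_def by blast
      moreover have "rho (e, 0, c, e) *\<^sub>v w \<in> W" if "c \<in> F" "w \<in> W" for c w
        using lower[OF that(1) W] that(2) unfolding act_def by blast
      ultimately show ?thesis using invariant_subspace_trivial[OF sub[OF W]] nz[OF W] by blast
    qed
    then have "\<W> \<subseteq> {carrier_vec n}" by auto
    then have "card \<W> \<le> card {carrier_vec n :: complex vec set}" by (intro card_mono) auto
    then show False using two by simp
  qed
qed

end

section \<open>Counting, and the distance between the two representations\<close>

context odd_finite_field
begin

text \<open>
  A matrix with \<open>c \<noteq> 0\<close> is determined by \<open>a\<close>, \<open>c\<close>, \<open>d\<close>, and one with \<open>c = 0\<close> by \<open>a \<noteq> 0\<close> and \<open>b\<close>.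
\<close>

lemma order_sl2_ge:
  "card F * ((card F - 1) * (card F + 1)) \<le> Coset.order sl2"
proof -
  define f1 where "f1 = (\<lambda>(a, c, d). (a, finv c * (a * d - e), c, d))"
  define f2 where "f2 = (\<lambda>(a, b :: 'a). (a, b, 0 :: 'a, finv a))"
  have "f1 ` (F \<times> (F - {0}) \<times> F) \<union> f2 ` ((F - {0}) \<times> F) \<subseteq> carrier sl2"
  proof -
    have "finv c * (a * d - e) * c = a * d - e" if "a \<in> F" "c \<in> F" "c \<noteq> 0" "d \<in> F" for a c d
      using finv_mult_left[of c "a * d - e"] that by (simp add: mult_ac)
    then have "f1 p \<in> carrier sl2" if "p \<in> F \<times> (F - {0}) \<times> F" for p
      using that by (cases p) (simp add: f1_def)
    moreover have "f2 p \<in> carrier sl2" if "p \<in> (F - {0}) \<times> F" for p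
      using that by (cases p) (simp add: f2_def)
    ultimately show ?thesis by blast
  qed
  then have "card (f1 ` (F \<times> (F - {0}) \<times> F) \<union> f2 ` ((F - {0}) \<times> F)) \<le> Coset.order sl2"
    unfolding Coset.order_def by (intro card_mono) auto
  also have "card (f1 ` (F \<times> (F - {0}) \<times> F) \<union> f2 ` ((F - {0}) \<times> F)) =
      card (f1 ` (F \<times> (F - {0}) \<times> F)) + card (f2 ` ((F - {0}) \<times> F))"
    by (intro card_Un_disjoint) (auto simp: f1_def f2_def)
  also have "card (f1 ` (F \<times> (F - {0}) \<times> F)) = card F * ((card F - 1) * card F)"
    by (subst card_image) (auto simp: f1_def inj_on_def card_cartesian_product)
  also have "card (f2 ` ((F - {0}) \<times> F)) = (card F - 1) * card F"
    by (subst card_image) (auto simp: f2_def inj_on_def card_cartesian_product)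
  finally show ?thesis by (simp add: algebra_simps)
qed

text \<open>
  Matrices of trace \<open>2\<close> with \<open>c \<noteq> 0\<close> are determined by \<open>u = a - 1\<close> and \<open>c\<close>, because \<open>b c = - u\<^sup>2\<close>; those with
  \<open>c = 0\<close> are the upper unipotent ones. Negation gives the matrices of trace \<open>- 2\<close>.
\<close>

lemma card_nonscalar_trace_pm_two_le:
  "card {(a, b, c, d). (a, b, c, d) \<in> carrier sl2 \<and> (a + d = e + e \<or> a + d = - (e + e)) \<and>
      \<not> (b = 0 \<and> c = 0)} \<le> 2 * ((card F - 1) * (card F + 1))" (is "card ?B \<le> _")
proof -
  define h1 where "h1 = (\<lambda>(u, c). (e + u, finv c * - (u * u), c, e - u))"
  define h2 where "h2 b = (e, b, 0 :: 'a, e)" for b :: 'a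
  define P where "P = h1 ` (F \<times> (F - {0})) \<union> h2 ` (F - {0})"
  define neg where "neg = (\<lambda>(a :: 'a, b :: 'a, c :: 'a, d :: 'a). (- a, - b, - c, - d))"
  have finP: "finite P" by (simp add: P_def)
  have two: "(a, b, c, d) \<in> P"
    if g: "(a, b, c, d) \<in> carrier sl2" and tr: "a + d = e + e" and nt: "\<not> (b = 0 \<and> c = 0)" for a b c d
  proof -
    have F: "a \<in> F" "b \<in> F" "c \<in> F" "d \<in> F" and det: "a * d - b * c = e" using g by auto
    define u where "u = a - e"
    have u: "u \<in> F" "a = e + u" "d = e - u"
      using F tr by (auto simp: u_def algebra_simps)
    have "a * d = e * e - u * u" unfolding u(2,3) by (simp add: algebra_simps)
    then have "a * d = e - u * u" by simp
    then have bc: "b * c = - (u * u)" using det by (simp add: eq_neg_iff_add_eq_0 algebra_simps)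
    show ?thesis
    proof (cases "c = 0")
      case True
      then have "u = 0" using bc u by simp
      then have "(a, b, c, d) = h2 b" using True u by (simp add: h2_def)
      then show ?thesis using nt True F by (auto simp: P_def)
    next
      case False
      have "b = finv c * - (u * u)"
        using finv_mult_left[of c b] F False bc by (simp add: mult.commute)
      then have "(a, b, c, d) = h1 (u, c)" using u by (simp add: h1_def)
      then show ?thesis using u F False by (auto simp: P_def)
    qed
  qed
  have "?B \<subseteq> P \<union> neg ` P"
  proof clarify
    fix a b c d assume g: "(a, b, c, d) \<in> carrier sl2" "a + d = e + e \<or> a + d = - (e + e)"
      "\<not> (b = 0 \<and> c = 0)" and n: "(a, b, c, d) \<notin> neg ` P"
    show "(a, b, c, d) \<in> P"
    proof (cases "a + d = e + e")
      case False
      then have s: "a + d = - (e + e)" using g by simp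
      have "- a + - d = - (a + d)" by simp
      also have "\<dots> = e + e" unfolding s by simp
      finally have "(- a, - b, - c, - d) \<in> P" using g by (intro two) auto
      then have "neg (- a, - b, - c, - d) \<in> neg ` P" by blast
      then show ?thesis using n by (simp add: neg_def)
    qed (use g two in auto)
  qed
  then have "card ?B \<le> card (P \<union> neg ` P)" using finP by (intro card_mono) auto
  also have "\<dots> \<le> card P + card P"
    using card_Un_le[of P "neg ` P"] card_image_le[OF finP, of neg] by linarith
  finally have cB: "card ?B \<le> card P + card P" .
  have cP: "card P \<le> card F * (card F - 1) + (card F - 1)"
  proof -
    have "card (h1 ` (F \<times> (F - {0}))) \<le> card (F \<times> (F - {0}))" by (rule card_image_le) simp
    moreover have "card (h2 ` (F - {0})) \<le> card (F - {0})" by (rule card_image_le) simp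
    ultimately show ?thesis
      using card_Un_le[of "h1 ` (F \<times> (F - {0}))" "h2 ` (F - {0})"]
      by (simp add: P_def card_cartesian_product)
  qed
  have arith: "(m * k + k) + (m * k + k) = 2 * (k * (m + 1))" for m k :: nat
    by (simp add: algebra_simps)
  have "card ?B \<le> (card F * (card F - 1) + (card F - 1)) + (card F * (card F - 1) + (card F - 1))"
    using cB cP by linarith
  then show ?thesis unfolding arith .
qed

end

text \<open>
  The parts of parity \<open>\<sigma>\<close> belonging to \<open>\<psi>\<close> and to its twist \<open>\<psi>'\<close> by a nonsquare realize the bound.
\<close>

theorem (in additive_character) d_natural_le_weil:
  assumes sigma: "\<sigma> = 1 \<or> \<sigma> = - 1"
  shows "d_natural (card (parity_index \<sigma>)) \<le> 2 / real (card F)"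
proof -
  define n where "n = card (parity_index \<sigma>)"
  have "finite (parity_index \<sigma>)" by (simp add: parity_index_def)
  then obtain \<beta> where \<beta>: "bij_betw \<beta> {..<n} (parity_index \<sigma>)"
    unfolding n_def using ex_bij_betw_nat_finite by (metis atLeast0LessThan)
  obtain m where m: "m \<in> F" "m \<noteq> 0" "m \<notin> squares" using exists_nonsquare by blast
  interpret A: weil_part F e \<psi> \<sigma> \<beta> n
    by unfold_locales (use sigma \<beta> in auto)
  define \<psi>' where "\<psi>' x = \<psi> (m * x)" for x
  interpret B: additive_character F e \<psi>'
    unfolding \<psi>'_def using scale_character[OF m(1,2)] .
  interpret B: weil_part F e \<psi>' \<sigma> \<beta> n
    by unfold_locales (use sigma \<beta> in auto)
  have ineq: "\<not> equivalent_reps n sl2 A.rho B.rho"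
  proof
    assume "equivalent_reps n sl2 A.rho B.rho"
    then obtain T where T: "T \<in> carrier (GL n)"
      and eq: "\<And>g. g \<in> carrier sl2 \<Longrightarrow> T * A.rho g = B.rho g * T"
      unfolding equivalent_reps_def by blast
    from T obtain T' where TT: "T \<in> carrier_mat n n" "T' \<in> carrier_mat n n" "T * T' = 1\<^sub>m n"
      unfolding GL_def units_of_def Units_def ring_mat_def by auto
    obtain y where "y \<in> half" using half_nonempty by blast
    then have "y \<in> parity_index \<sigma>" "y \<noteq> 0" using half_subset by (auto simp: parity_index_def)
    then obtain i where i: "i < n" "\<beta> i \<noteq> 0"
      using \<beta> unfolding bij_betw_def by (metis imageE lessThan_iff)
    have "T $$ (i, j) = 0" if j: "j < n" for j
    proof (rule ccontr)
      assume nz: "T $$ (i, j) \<noteq> 0"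
      have "\<psi> ((\<beta> j * \<beta> j - m * (\<beta> i * \<beta> i)) * b) = 1" if b: "b \<in> F" for b
      proof -
        let ?g = "(e, b, 0, e)"
        have g: "?g \<in> carrier sl2" using b by simp
        have "(T * A.rho ?g) $$ (i, j) = (\<Sum>k\<in>{0..<n}. T $$ (i, k) * A.rho ?g $$ (k, j))"
          using TT i j by (simp add: scalar_prod_def)
        also have "\<dots> = (\<Sum>k\<in>{0..<n}. if k = j then T $$ (i, j) * \<psi> (b * (\<beta> j * \<beta> j)) else 0)"
          using b j by (intro sum.cong) (auto simp: A.part_unipotent A.beta_inj)
        finally have 1: "(T * A.rho ?g) $$ (i, j) = T $$ (i, j) * \<psi> (b * (\<beta> j * \<beta> j))"
          using j by simp
        have "(B.rho ?g * T) $$ (i, j) = (\<Sum>k\<in>{0..<n}. B.rho ?g $$ (i, k) * T $$ (k, j))"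
          using TT i j by (simp add: scalar_prod_def)
        also have "\<dots> = (\<Sum>k\<in>{0..<n}. if k = i then T $$ (i, j) * \<psi>' (b * (\<beta> i * \<beta> i)) else 0)"
          using b i by (intro sum.cong) (auto simp: B.part_unipotent A.beta_inj)
        finally have 2: "(B.rho ?g * T) $$ (i, j) = T $$ (i, j) * \<psi>' (b * (\<beta> i * \<beta> i))"
          using i by simp
        have eq': "\<psi> (b * (\<beta> j * \<beta> j)) = \<psi> (m * (b * (\<beta> i * \<beta> i)))"
          using eq[OF g] 1 2 nz by (simp add: \<psi>'_def)
        have "(\<beta> j * \<beta> j - m * (\<beta> i * \<beta> i)) * b = - (m * (b * (\<beta> i * \<beta> i))) + b * (\<beta> j * \<beta> j)"
          by (simp add: algebra_simps)
        then have "\<psi> ((\<beta> j * \<beta> j - m * (\<beta> i * \<beta> i)) * b) =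
            \<psi> (- (m * (b * (\<beta> i * \<beta> i)))) * \<psi> (b * (\<beta> j * \<beta> j))"
          using psi_add[of "- (m * (b * (\<beta> i * \<beta> i)))" "b * (\<beta> j * \<beta> j)"] b i j m by simp
        then show ?thesis unfolding eq' using b i m by simp
      qed
      then have "(\<Sum>b\<in>F. \<psi> ((\<beta> j * \<beta> j - m * (\<beta> i * \<beta> i)) * b)) = of_nat (card F)" by simp
      then have "\<beta> j * \<beta> j - m * (\<beta> i * \<beta> i) = 0"
        using i j m by (subst (asm) sum_psi) (auto split: if_splits)
      then have bj: "\<beta> j * \<beta> j = (\<beta> i * \<beta> i) * m" by (simp add: mult.commute)
      have "\<beta> i * \<beta> i \<in> squares" using i by (auto simp: squares_def)
      then have "(\<beta> i * \<beta> i) * m \<notin> squares" using square_mult_squares m by simp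
      moreover have "\<beta> j \<noteq> 0"
      proof
        assume "\<beta> j = 0"
        then have "(\<beta> i * \<beta> i) * m = 0" using bj by simp
        then show False using i m by simp
      qed
      then have "\<beta> j * \<beta> j \<in> squares" using j by (auto simp: squares_def)
      ultimately show False by (simp add: bj)
    qed
    then have "(T * T') $$ (i, i) = 0"
      using TT(1,2) i by (simp add: scalar_prod_def)
    then show False using TT(3) i by simp
  qed
  have "char_dist sl2 A.rho B.rho \<le> 2 / real (card F)"
  proof -
    let ?q = "card F"
    let ?B = "{(a, b, c, d). (a, b, c, d) \<in> carrier sl2 \<and> (a + d = e + e \<or> a + d = - (e + e)) \<and>
      \<not> (b = 0 \<and> c = 0)}"
    define N where "N = (?q - 1) * (?q + 1)"
    have N: "N > 0" using card_F by (simp add: N_def card_gt_0_iff)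
    have "{g \<in> carrier sl2. character A.rho g \<noteq> character B.rho g} \<subseteq>
      ?B"
    proof
      fix g assume "g \<in> {g \<in> carrier sl2. character A.rho g \<noteq> character B.rho g}"
      moreover obtain a b c d where gabcd: "g = (a, b, c, d)" by (metis prod_cases4)
      ultimately have g: "(a, b, c, d) \<in> carrier sl2"
        and ne: "character A.rho (a, b, c, d) \<noteq> character B.rho (a, b, c, d)" by blast+
      have "\<not> (b = 0 \<and> c = 0)"
      proof
        assume bc: "b = 0 \<and> c = 0"
        show False
          using ne bc by (simp add: A.character_rho B.character_rho A.weil_diagonal_matrix B.weil_diagonal_matrix)
      qed
      moreover have "a + d = e + e \<or> a + d = - (e + e)"
        using A.character_rho_generic[OF g] B.character_rho_generic[OF g] ne by metis
      ultimately show "g \<in> ?B"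
        using g unfolding gabcd by blast
    qed
    then have "card {g \<in> carrier sl2. character A.rho g \<noteq> character B.rho g} \<le>
      card ?B"
    proof (intro card_mono)
      show "finite ?B" by (rule finite_subset[OF _ finite_sl2]) blast
    qed
    also have "\<dots> \<le> 2 * N" unfolding N_def by (rule card_nonscalar_trace_pm_two_le)
    finally have le: "card {g \<in> carrier sl2. character A.rho g \<noteq> character B.rho g} \<le> 2 * N" .
    have ge: "?q * N \<le> Coset.order sl2" unfolding N_def by (rule order_sl2_ge)
    have "char_dist sl2 A.rho B.rho \<le> real (2 * N) / real (?q * N)"
    proof (unfold char_dist_def, rule frac_le[OF _ of_nat_mono[OF le] _ of_nat_mono[OF ge]])
      have "?q > 0" using card_F by simp
      then show "0 < real (?q * N)" using N by simp
    qed simp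
    also have "\<dots> = 2 / real ?q" using N by simp
    finally show ?thesis .
  qed
  moreover have mem: "char_dist sl2 A.rho B.rho \<in> primitive_dists n sl2"
    unfolding primitive_dists_def using A.primitive_rho B.primitive_rho ineq by blast
  moreover have "bdd_below (primitive_dists n sl2)"
    by (rule bdd_belowI[of _ 0]) (auto simp: primitive_dists_def char_dist_def)
  ultimately have "delta_natural n sl2 \<le> 2 / real (card F)"
    unfolding delta_natural_def using cInf_lower[OF mem] by auto
  moreover have "d_natural n \<le> delta_natural n sl2"
    by (rule d_natural_le[OF group_sl2 finite_sl2])
  ultimately show ?thesis by (simp add: n_def)
qed

theorem corollary1p5:
  fixes q :: nat
  assumes "primepow q" and "odd q" and "q > 3"
  shows "d_natural ((q + 1) div 2) \<le> 2 / real q \<and> d_natural ((q - 1) div 2) \<le> 2 / real q"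
proof -
  obtain F and e :: galois_product where F: "odd_finite_field F e" "card F = q"
    using exists_odd_finite_field[OF assms(1,2)] by blast
  interpret odd_finite_field F e by (rule F)
  obtain \<psi> where "additive_character F e \<psi>" using exists_additive_character by blast
  then interpret additive_character F e \<psi> .
  have q: "q = 2 * card half + 1" using card_F F(2) by simp
  have "0 \<notin> half" using half_subset by auto
  then have "card (parity_index 1) = (q + 1) div 2" "card (parity_index (- 1)) = (q - 1) div 2"
    by (simp_all add: parity_index_def q)
  then show ?thesis
    using d_natural_le_weil[of 1] d_natural_le_weil[of "- 1"] F(2) by simp
qed

end
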